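(* Let $\mathcal{M}$ be a Hadamard manifold, $\mathcal{D}\subseteq\mathcal{M}$ a nonempty open subset, $f:\mathcal{D}\to\mathcal{I}(\mathbb{R})$ an interval valued function, and $x_0\in\mathcal{D}$ such that $f$ is $gH$-Gâteaux differentiable at $x_0$. Write $f_G(x_0)(v)=[\underline{f}_G(x_0)(v),\overline{f}_G(x_0)(v)]$ for $v\in T_{x_0}\mathcal{M}$. (a) If $x_0$ is an efficient point of the problem $\min_{x\in\mathcal{D}}f(x)$, then $0\in f_G(x_0)(\exp_{x_0}^{-1}x)$ for all $x\in\mathcal{D}$. (b) If $\mathcal{D}$ is geodesically convex, $f$ is geodesically convex on $\mathcal{D}$, and $0\in\big[\underline{f}_G(x_0)(\exp_{x_0}^{-1}x),\ \overline{f}_G(x_0)(\exp_{x_0}^{-1}x)\big)$ for all $x\in\mathcal{D}\setminus\{x_0\}$, then $x_0$ is an efficient point of the problem $\min_{x\in\mathcal{D}}f(x)$.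
   Context: $\mathcal{I}(\mathbb{R})$ is the set of closed bounded intervals $[\underline{a},\overline{a}]$ with $\underline{a}\le\overline{a}$ real; $\mathbf{0}=[0,0]$. Sums and scalar multiples are Minkowski: $A+B=[\underline{a}+\underline{b},\overline{a}+\overline{b}]$, and $\lambda A=[\lambda\underline{a},\lambda\overline{a}]$ if $\lambda\ge0$, $\lambda A=[\lambda\overline{a},\lambda\underline{a}]$ if $\lambda<0$. The $gH$-difference is $A-_{gH}B=[\min\{\underline{a}-\underline{b},\overline{a}-\overline{b}\},\max\{\underline{a}-\underline{b},\overline{a}-\overline{b}\}]$. The Hausdorff metric is $d_H(A,B)=\max\{|\underline{a}-\underline{b}|,|\overline{a}-\overline{b}|\}$; limits of intervals are taken in $d_H$. Order: $A\preceq B$ iff $\underline{a}\le\underline{b}$ and $\overline{a}\le\overline{b}$; $A\prec B$ iff $A\preceq B$ and $A\ne B$; $A\nprec B$ means that $A\prec B$ fails. The half-open interval $[l,u)$ is $\{r\in\mathbb{R}: l\le r<u\}$. A Hadamard manifold is a simply connected complete Riemannian manifold of nonpositive sectional curvature; $\exp_x:T_x\mathcal{M}\to\mathcal{M}$ is then a diffeomorphism, and the minimal geodesic joining $x$ to $y$ is $\gamma(t)=\exp_x(t\exp_x^{-1}y)$, $t\in[0,1]$. A set $\mathcal{D}\subseteq\mathcal{M}$ is geodesically convex if it contains the minimal geodesic joining any two of its points. For geodesically convex $\mathcal{D}$, $f:\mathcal{D}\to\mathcal{I}(\mathbb{R})$ is geodesically convex on $\mathcal{D}$ if $f(\gamma(t))\preceq(1-t)f(x)+tf(y)$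 for all $x,y\in\mathcal{D}$, $t\in[0,1]$, where $\gamma:[0,1]\to\mathcal{M}$ is the minimal geodesic from $x$ to $y$. For $\mathcal{D}$ open, $f$ has $gH$-directional derivative $f'(x,v)\in\mathcal{I}(\mathbb{R})$ at $x\in\mathcal{D}$ in direction $v\in T_x\mathcal{M}$ if the limit $f'(x,v)=\lim_{t\to0^+}\frac1t\big(f(\exp_x(tv))-_{gH}f(x)\big)$ exists; $f$ is $gH$-directional differentiable at $x$ if this holds for every $v\in T_x\mathcal{M}$. For a finite-dimensional real normed space $V$, a map $F:V\to\mathcal{I}(\mathbb{R})$ is linear if (i) $F(\lambda v)=\lambda F(v)$ for all $v\in V,\lambda\in\mathbb{R}$, and (ii) for all $v,w\in V$, either $F(v)+F(w)=F(v+w)$ or neither $F(v)+F(w)\prec F(v+w)$ nor $F(v+w)\prec F(v)+F(w)$. It is $gH$-continuous if $\lim_{\|h\|\to0}(F(v+h)-_{gH}F(v))=\mathbf{0}$ for every $v\in V$. $f$ is $gH$-Gâteaux differentiable at $x_0$ if it is $gH$-directional differentiable at $x_0$ and $f_G(x_0)(\cdot):=f'(x_0,\cdot):T_{x_0}\mathcal{M}\to\mathcal{I}(\mathbb{R})$ is linear and $gH$-continuous. A point $x_0\in\mathcal{D}$ is an efficient point of $\min_{x\in\mathcal{D}}f(x)$ if $f(x)\nprec f(x_0)$ for all $x\in\mathcal{D}$. *)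

theory Defs
  imports "HOL-Analysis.Analysis" "HOL-Library.Interval"
begin

section \<open>Compact real intervals\<close>

text \<open>
  The order that the library puts on \<open>real interval\<close> is inclusion, and its subtraction is the
  Minkowski one. Neither is used here. Sum and zero are those of the library.
  For \<open>a \<le> b\<close> the interval \<open>[a, b]\<close> is \<open>Interval (a, b)\<close>.
\<close>

lemma lower_Interval: "a \<le> b \<Longrightarrow> lower (Interval (a, b)) = a"
  by (simp add: lower.rep_eq Interval_inverse)

lemma upper_Interval: "a \<le> b \<Longrightarrow> upper (Interval (a, b)) = b"
  by (simp add: upper.rep_eq Interval_inverse)

definition ivl_scale :: "real \<Rightarrow> real interval \<Rightarrow> real interval" where
  "ivl_scale c A =
     (if 0 \<le> c then Interval (c * lower A, c * upper A) else Interval (c * upper A, c * lower A))"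

lemma lower_ivl_scale: "lower (ivl_scale c A) = (if 0 \<le> c then c * lower A else c * upper A)"
  by (simp add: ivl_scale_def lower_Interval mult_left_mono mult_left_mono_neg)

lemma upper_ivl_scale: "upper (ivl_scale c A) = (if 0 \<le> c then c * upper A else c * lower A)"
  by (simp add: ivl_scale_def upper_Interval mult_left_mono mult_left_mono_neg)

definition gH_diff :: "real interval \<Rightarrow> real interval \<Rightarrow> real interval" where
  "gH_diff A B = Interval (min (lower A - lower B) (upper A - upper B),
                           max (lower A - lower B) (upper A - upper B))"

lemma lower_gH_diff: "lower (gH_diff A B) = min (lower A - lower B) (upper A - upper B)"
  unfolding gH_diff_def by (rule lower_Interval) simp

lemma upper_gH_diff: "upper (gH_diff A B) = max (lower A - lower B) (upper A - upper B)"
  unfolding gH_diff_def by (rule upper_Interval) simp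

definition ivl_dist :: "real interval \<Rightarrow> real interval \<Rightarrow> real" where
  "ivl_dist A B = max \<bar>lower A - lower B\<bar> \<bar>upper A - upper B\<bar>"

definition ivl_tendsto :: "('a \<Rightarrow> real interval) \<Rightarrow> real interval \<Rightarrow> 'a filter \<Rightarrow> bool" where
  "ivl_tendsto F L net \<longleftrightarrow> ((\<lambda>t. ivl_dist (F t) L) \<longlongrightarrow> 0) net"

definition ivl_le :: "real interval \<Rightarrow> real interval \<Rightarrow> bool" where
  "ivl_le A B \<longleftrightarrow> lower A \<le> lower B \<and> upper A \<le> upper B"

definition ivl_less :: "real interval \<Rightarrow> real interval \<Rightarrow> bool" where
  "ivl_less A B \<longleftrightarrow> ivl_le A B \<and> A \<noteq> B"

definition ivl_linear :: "('v::real_normed_vector \<Rightarrow> real interval) \<Rightarrow> bool" where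
  "ivl_linear F \<longleftrightarrow>
     (\<forall>v c. F (c *\<^sub>R v) = ivl_scale c (F v)) \<and>
     (\<forall>v w. F v + F w = F (v + w) \<or>
        (\<not> ivl_less (F v + F w) (F (v + w)) \<and> \<not> ivl_less (F (v + w)) (F v + F w)))"

definition gH_continuous :: "('v::real_normed_vector \<Rightarrow> real interval) \<Rightarrow> bool" where
  "gH_continuous F \<longleftrightarrow> (\<forall>v. ivl_tendsto (\<lambda>h. gH_diff (F (v + h)) (F v)) 0 (at 0))"


section \<open>Smooth manifolds\<close>

text \<open>
  For a function on an open subset \<open>S\<close> of a finite-dimensional space, \<open>Ck_on k S f\<close> says that
  \<open>f\<close> is \<open>k\<close> times continuously differentiable: all iterated directional derivatives up to order
  \<open>k\<close> exist and are continuous.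
\<close>

primrec Ck_on ::
  "nat \<Rightarrow> 'a::real_normed_vector set \<Rightarrow> ('a \<Rightarrow> 'b::real_normed_vector) \<Rightarrow> bool" where
  "Ck_on 0 S f \<longleftrightarrow> continuous_on S f"
| "Ck_on (Suc k) S f \<longleftrightarrow>
     (\<forall>x\<in>S. f differentiable (at x)) \<and> (\<forall>v. Ck_on k S (\<lambda>x. frechet_derivative f (at x) v))"

definition smooth_on ::
  "'a::real_normed_vector set \<Rightarrow> ('a \<Rightarrow> 'b::real_normed_vector) \<Rightarrow> bool" where
  "smooth_on S f \<longleftrightarrow> (\<forall>k. Ck_on k S f)"

text \<open>
  A chart is a pair of its domain and its coordinate map; the values of the coordinate map outside
  the domain are irrelevant. The manifold is the whole type \<open>'m\<close>.
\<close>

type_synonym ('m, 'e) chart = "'m set \<times> ('m \<Rightarrow> 'e)"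

abbreviation chart_dom :: "('m, 'e) chart \<Rightarrow> 'm set" where
  "chart_dom c \<equiv> fst c"

abbreviation chart_map :: "('m, 'e) chart \<Rightarrow> 'm \<Rightarrow> 'e" where
  "chart_map c \<equiv> snd c"

definition chart_inv :: "('m, 'e) chart \<Rightarrow> 'e \<Rightarrow> 'm" where
  "chart_inv c = inv_into (chart_dom c) (chart_map c)"

definition chart_image :: "('m, 'e) chart \<Rightarrow> 'e set" where
  "chart_image c = chart_map c ` chart_dom c"

definition is_chart :: "('m::topological_space, 'e::real_normed_vector) chart \<Rightarrow> bool" where
  "is_chart c \<longleftrightarrow> open (chart_dom c) \<and> open (chart_image c) \<and>
     homeomorphism (chart_dom c) (chart_image c) (chart_map c) (chart_inv c)"

definition transition :: "('m, 'e) chart \<Rightarrow> ('m, 'e) chart \<Rightarrow> 'e \<Rightarrow> 'e" where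
  "transition c d = chart_map d \<circ> chart_inv c"

text \<open>
  The model space is an arbitrary finite-dimensional real inner product space. The class
  \<open>euclidean_space\<close> is avoided because it forces the dimension to be positive.
\<close>

definition smooth_manifold ::
  "('m::{t2_space, second_countable_topology}, 'e::real_inner) chart set \<Rightarrow> bool" where
  "smooth_manifold A \<longleftrightarrow>
     (\<exists>B::'e set. finite B \<and> span B = UNIV) \<and>
     (\<forall>c\<in>A. is_chart c) \<and> (\<Union>c\<in>A. chart_dom c) = UNIV \<and>
     (\<forall>c\<in>A. \<forall>d\<in>A. smooth_on (chart_map c ` (chart_dom c \<inter> chart_dom d)) (transition c d))"

text \<open>
  The tangent space at \<open>x\<close> is represented by the model space \<open>'e\<close>: a tangent vector is given by its
  coordinates in one selected chart around \<open>x\<close>. The coordinates of the same tangent vector in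
  another chart are obtained with the derivative of the transition map.
\<close>

definition chart_at :: "('m, 'e) chart set \<Rightarrow> 'm \<Rightarrow> ('m, 'e) chart" where
  "chart_at A x = (SOME c. c \<in> A \<and> x \<in> chart_dom c)"

definition tangent_coord_change ::
  "('m, 'e::real_normed_vector) chart \<Rightarrow> ('m, 'e) chart \<Rightarrow> 'm \<Rightarrow> 'e \<Rightarrow> 'e" where
  "tangent_coord_change c d x v = frechet_derivative (transition c d) (at (chart_map c x)) v"


section \<open>Riemannian metrics\<close>

text \<open>
  A metric \<open>g\<close> assigns to \<open>x\<close> an inner product \<open>g x\<close> on the tangent space at \<open>x\<close>.
  Its expression in the chart \<open>c\<close> is a field \<open>G\<close> of inner products on the image of \<open>c\<close>;
  \<open>G y u v\<close> is the product of the vectors with \<open>c\<close>-coordinates \<open>u\<close>, \<open>v\<close> at the point with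
  \<open>c\<close>-coordinates \<open>y\<close>.
\<close>

definition local_metric ::
  "('m, 'e::real_normed_vector) chart set \<Rightarrow> ('m \<Rightarrow> 'e \<Rightarrow> 'e \<Rightarrow> real) \<Rightarrow> ('m, 'e) chart
    \<Rightarrow> 'e \<Rightarrow> 'e \<Rightarrow> 'e \<Rightarrow> real" where
  "local_metric A g c y u v =
     (let x = chart_inv c y; \<tau> = tangent_coord_change c (chart_at A x) x in g x (\<tau> u) (\<tau> v))"

definition riemannian_metric ::
  "('m, 'e::real_inner) chart set \<Rightarrow> ('m \<Rightarrow> 'e \<Rightarrow> 'e \<Rightarrow> real) \<Rightarrow> bool" where
  "riemannian_metric A g \<longleftrightarrow>
     (\<forall>x. bilinear (g x) \<and> (\<forall>u v. g x u v = g x v u) \<and> (\<forall>v. v \<noteq> 0 \<longrightarrow> 0 < g x v v)) \<and>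
     (\<forall>c\<in>A. \<forall>u v. smooth_on (chart_image c) (\<lambda>y. local_metric A g c y u v))"

text \<open>
  The Levi-Civita connection in a chart is \<open>\<nabla>\<^sub>u V = D V u + \<Gamma>(u, V)\<close>, where the Koszul formula
  for constant vector fields determines \<open>\<Gamma>\<close>.
\<close>

definition christoffel ::
  "('e \<Rightarrow> 'e \<Rightarrow> 'e \<Rightarrow> real) \<Rightarrow> 'e \<Rightarrow> 'e \<Rightarrow> 'e \<Rightarrow> 'e::real_normed_vector" where
  "christoffel G y u v = (THE z. \<forall>w. 2 * G y z w =
       frechet_derivative (\<lambda>p. G p v w) (at y) u
     + frechet_derivative (\<lambda>p. G p u w) (at y) v
     - frechet_derivative (\<lambda>p. G p u v) (at y) w)"

text \<open>\<open>R(u, v) w = \<nabla>\<^sub>u \<nabla>\<^sub>v w - \<nabla>\<^sub>v \<nabla>\<^sub>u w\<close> for constant vector fields \<open>u\<close>, \<open>v\<close>, \<open>w\<close>.\<close>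

definition riemann_curvature ::
  "('e \<Rightarrow> 'e \<Rightarrow> 'e \<Rightarrow> real) \<Rightarrow> 'e \<Rightarrow> 'e \<Rightarrow> 'e \<Rightarrow> 'e \<Rightarrow> 'e::real_normed_vector" where
  "riemann_curvature G y u v w =
       frechet_derivative (\<lambda>p. christoffel G p v w) (at y) u
     - frechet_derivative (\<lambda>p. christoffel G p u w) (at y) v
     + christoffel G y u (christoffel G y v w)
     - christoffel G y v (christoffel G y u w)"

definition sectional_curvature ::
  "('m, 'e::real_normed_vector) chart set \<Rightarrow> ('m \<Rightarrow> 'e \<Rightarrow> 'e \<Rightarrow> real) \<Rightarrow> 'm \<Rightarrow> 'e \<Rightarrow> 'e \<Rightarrow> real" where
  "sectional_curvature A g x u v =
     (let G = local_metric A g (chart_at A x); y = chart_map (chart_at A x) x in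
        G y (riemann_curvature G y u v v) u / (G y u u * G y v v - (G y u v)\<^sup>2))"

definition nonpositive_sectional_curvature ::
  "('m, 'e::real_normed_vector) chart set \<Rightarrow> ('m \<Rightarrow> 'e \<Rightarrow> 'e \<Rightarrow> real) \<Rightarrow> bool" where
  "nonpositive_sectional_curvature A g \<longleftrightarrow>
     (\<forall>x u v. u \<noteq> v \<and> independent {u, v} \<longrightarrow> sectional_curvature A g x u v \<le> 0)"

text \<open>Geodesics defined on all of \<open>\<real>\<close>: in every chart, \<open>y'' + \<Gamma>(y', y') = 0\<close>.\<close>

definition is_geodesic ::
  "('m::topological_space, 'e::real_normed_vector) chart set \<Rightarrow> ('m \<Rightarrow> 'e \<Rightarrow> 'e \<Rightarrow> real)
    \<Rightarrow> (real \<Rightarrow> 'm) \<Rightarrow> bool" where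
  "is_geodesic A g \<gamma> \<longleftrightarrow>
     continuous_on UNIV \<gamma> \<and>
     (\<forall>c\<in>A. \<forall>t. \<gamma> t \<in> chart_dom c \<longrightarrow>
        (let y = chart_map c \<circ> \<gamma>; y' = (\<lambda>s. vector_derivative y (at s)) in
           y differentiable (at t) \<and>
           (y' has_vector_derivative - christoffel (local_metric A g c) (y t) (y' t) (y' t)) (at t)))"

definition geodesic_from ::
  "('m::topological_space, 'e::real_normed_vector) chart set \<Rightarrow> ('m \<Rightarrow> 'e \<Rightarrow> 'e \<Rightarrow> real)
    \<Rightarrow> 'm \<Rightarrow> 'e \<Rightarrow> (real \<Rightarrow> 'm) \<Rightarrow> bool" where
  "geodesic_from A g x v \<gamma> \<longleftrightarrow>
     is_geodesic A g \<gamma> \<and> \<gamma> 0 = x \<and> vector_derivative (chart_map (chart_at A x) \<circ> \<gamma>) (at 0) = v"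

definition complete_metric ::
  "('m::topological_space, 'e::real_normed_vector) chart set \<Rightarrow> ('m \<Rightarrow> 'e \<Rightarrow> 'e \<Rightarrow> real) \<Rightarrow> bool" where
  "complete_metric A g \<longleftrightarrow> (\<forall>x v. \<exists>\<gamma>. geodesic_from A g x v \<gamma>)"

definition hadamard_manifold ::
  "('m::{t2_space, second_countable_topology}, 'e::real_inner) chart set
    \<Rightarrow> ('m \<Rightarrow> 'e \<Rightarrow> 'e \<Rightarrow> real) \<Rightarrow> bool" where
  "hadamard_manifold A g \<longleftrightarrow>
     smooth_manifold A \<and> riemannian_metric A g \<and> simply_connected (UNIV :: 'm set) \<and>
     complete_metric A g \<and> nonpositive_sectional_curvature A g"

text \<open>The geodesic with given initial point and velocity is unique, so \<open>THE\<close> is justified here.\<close>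

definition riem_exp ::
  "('m::topological_space, 'e::real_normed_vector) chart set \<Rightarrow> ('m \<Rightarrow> 'e \<Rightarrow> 'e \<Rightarrow> real)
    \<Rightarrow> 'm \<Rightarrow> 'e \<Rightarrow> 'm" where
  "riem_exp A g x v = (THE \<gamma>. geodesic_from A g x v \<gamma>) 1"

text \<open>On a Hadamard manifold \<open>riem_exp A g x\<close> is a bijection (Cartan--Hadamard).\<close>

definition riem_log ::
  "('m::topological_space, 'e::real_normed_vector) chart set \<Rightarrow> ('m \<Rightarrow> 'e \<Rightarrow> 'e \<Rightarrow> real)
    \<Rightarrow> 'm \<Rightarrow> 'm \<Rightarrow> 'e" where
  "riem_log A g x = inv (riem_exp A g x)"

definition minimal_geodesic ::
  "('m::topological_space, 'e::real_normed_vector) chart set \<Rightarrow> ('m \<Rightarrow> 'e \<Rightarrow> 'e \<Rightarrow> real)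
    \<Rightarrow> 'm \<Rightarrow> 'm \<Rightarrow> real \<Rightarrow> 'm" where
  "minimal_geodesic A g x y t = riem_exp A g x (t *\<^sub>R riem_log A g x y)"


section \<open>Interval valued functions on a Hadamard manifold\<close>

definition geodesically_convex_set ::
  "('m::topological_space, 'e::real_normed_vector) chart set \<Rightarrow> ('m \<Rightarrow> 'e \<Rightarrow> 'e \<Rightarrow> real)
    \<Rightarrow> 'm set \<Rightarrow> bool" where
  "geodesically_convex_set A g D \<longleftrightarrow>
     (\<forall>x\<in>D. \<forall>y\<in>D. \<forall>t\<in>{0..1}. minimal_geodesic A g x y t \<in> D)"

definition geodesically_convex_on ::
  "('m::topological_space, 'e::real_normed_vector) chart set \<Rightarrow> ('m \<Rightarrow> 'e \<Rightarrow> 'e \<Rightarrow> real)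
    \<Rightarrow> 'm set \<Rightarrow> ('m \<Rightarrow> real interval) \<Rightarrow> bool" where
  "geodesically_convex_on A g D f \<longleftrightarrow>
     (\<forall>x\<in>D. \<forall>y\<in>D. \<forall>t\<in>{0..1}.
        ivl_le (f (minimal_geodesic A g x y t)) (ivl_scale (1 - t) (f x) + ivl_scale t (f y)))"

text \<open>
  In the following, \<open>f\<close> is only meant to be given on an open set containing \<open>x\<close>. Its values
  elsewhere do not matter, because the limit is taken for \<open>t\<close> tending to \<open>0\<close>.
\<close>

definition has_gH_dir_deriv ::
  "('m::topological_space, 'e::real_normed_vector) chart set \<Rightarrow> ('m \<Rightarrow> 'e \<Rightarrow> 'e \<Rightarrow> real)
    \<Rightarrow> ('m \<Rightarrow> real interval) \<Rightarrow> 'm \<Rightarrow> 'e \<Rightarrow> real interval \<Rightarrow> bool" where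
  "has_gH_dir_deriv A g f x v L \<longleftrightarrow>
     ivl_tendsto (\<lambda>t. ivl_scale (1 / t) (gH_diff (f (riem_exp A g x (t *\<^sub>R v))) (f x)))
       L (at_right 0)"

definition gH_dir_differentiable ::
  "('m::topological_space, 'e::real_normed_vector) chart set \<Rightarrow> ('m \<Rightarrow> 'e \<Rightarrow> 'e \<Rightarrow> real)
    \<Rightarrow> ('m \<Rightarrow> real interval) \<Rightarrow> 'm \<Rightarrow> bool" where
  "gH_dir_differentiable A g f x \<longleftrightarrow> (\<forall>v. \<exists>L. has_gH_dir_deriv A g f x v L)"

definition gH_deriv ::
  "('m::topological_space, 'e::real_normed_vector) chart set \<Rightarrow> ('m \<Rightarrow> 'e \<Rightarrow> 'e \<Rightarrow> real)
    \<Rightarrow> ('m \<Rightarrow> real interval) \<Rightarrow> 'm \<Rightarrow> 'e \<Rightarrow> real interval" where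
  "gH_deriv A g f x v = (THE L. has_gH_dir_deriv A g f x v L)"

text \<open>
  Continuity on the tangent space is understood for the norm of \<open>'e\<close>. As the tangent space is
  finite-dimensional, the norm of the Riemannian metric gives the same notion.
\<close>

definition gH_gateaux_differentiable ::
  "('m::topological_space, 'e::real_normed_vector) chart set \<Rightarrow> ('m \<Rightarrow> 'e \<Rightarrow> 'e \<Rightarrow> real)
    \<Rightarrow> ('m \<Rightarrow> real interval) \<Rightarrow> 'm \<Rightarrow> bool" where
  "gH_gateaux_differentiable A g f x \<longleftrightarrow>
     gH_dir_differentiable A g f x \<and> ivl_linear (gH_deriv A g f x) \<and> gH_continuous (gH_deriv A g f x)"

definition efficient_point :: "('m \<Rightarrow> real interval) \<Rightarrow> 'm set \<Rightarrow> 'm \<Rightarrow> bool" where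
  "efficient_point f D x0 \<longleftrightarrow> x0 \<in> D \<and> (\<forall>x\<in>D. \<not> ivl_less (f x) (f x0))"

end

theory Submission
  imports Defs
begin

text \<open>
  If \<open>x0\<close> is efficient, the difference quotients of \<open>f\<close> along \<open>t \<mapsto> exp (t v)\<close> have a nonnegative
  upper end point for small \<open>t\<close>, and so has their limit. Applied to \<open>v\<close> and to \<open>-v\<close>, where the
  derivative is reflected by linearity, this puts \<open>0\<close> into the derivative. Conversely, if some \<open>y\<close>
  dominates \<open>x0\<close>, convexity makes the difference quotients towards \<open>y\<close> nonpositive, which contradicts
  the positive upper end point of the derivative.

  The first half needs \<open>exp (t v)\<close> to stay in the open set \<open>D\<close> for small \<open>t\<close>. Since \<open>exp\<close> is a
  definite description over geodesics, this rests on uniqueness of geodesics: the Christoffel symbols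
  are locally Lipschitz, so two geodesics with the same initial data agree nearby by Gronwall, and
  the set of times near which they agree is open and closed in the real line.
\<close>

section \<open>Finite-dimensional inner product spaces\<close>

lemma abs_inner_le_norm:
  fixes b :: "'a::real_inner"
  assumes "norm b = 1"
  shows "\<bar>u \<bullet> b\<bar> \<le> norm u"
  using Cauchy_Schwarz_ineq2[of u b] assms by simp

text \<open>The model space is a \<open>real_inner\<close> space with some finite spanning set, so
  an orthonormal basis is carried along explicitly. The empty basis is allowed and covers dimension
  0.\<close>

locale finite_orthonormal_basis =
  fixes B :: "'e::real_inner set"
  assumes finite_basis: "finite B"
    and span_basis: "span B = UNIV"
    and orthogonal_basis: "pairwise orthogonal B"
    and norm_basis: "b \<in> B \<Longrightarrow> norm b = 1"
begin

lemma inner_basis: "b \<in> B \<Longrightarrow> c \<in> B \<Longrightarrow> b \<bullet> c = (if b = c then 1 else 0)"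
  using orthogonal_basis norm_basis
  by (auto simp: pairwise_def orthogonal_def norm_eq_1)

lemma basis_expansion: "u = (\<Sum>b\<in>B. (u \<bullet> b) *\<^sub>R b)"
proof -
  have "u \<in> span B" by (simp add: span_basis)
  then obtain a where a: "u = (\<Sum>b\<in>B. a b *\<^sub>R b)"
    using span_finite[OF finite_basis] by auto
  have "u \<bullet> c = a c" if "c \<in> B" for c
  proof -
    have "u \<bullet> c = (\<Sum>b\<in>B. a b * (b \<bullet> c))"
      unfolding a by (simp add: inner_sum_left)
    also have "\<dots> = (\<Sum>b\<in>B. if b = c then a c else 0)"
      using that by (intro sum.cong) (auto simp: inner_basis)
    finally show ?thesis using that finite_basis by simp
  qed
  then have "(\<Sum>b\<in>B. (u \<bullet> b) *\<^sub>R b) = (\<Sum>b\<in>B. a b *\<^sub>R b)"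
    by (intro sum.cong) auto
  then show ?thesis using a by simp
qed

lemma linear_expansion:
  fixes f :: "'e \<Rightarrow> 'b::real_vector"
  assumes "linear f"
  shows "f u = (\<Sum>b\<in>B. (u \<bullet> b) *\<^sub>R f b)"
  by (subst basis_expansion[of u]) (simp add: linear_sum[OF assms] linear_cmul[OF assms])

text \<open>Every coordinate of \<open>u\<close> is at most \<open>norm u\<close>. The explicit
  constant matters later: it depends on the map only through finitely many values on
  \<open>B\<close>, which can be controlled locally uniformly when the map varies with a
  point.\<close>

lemma linear_bound:
  fixes f :: "'e \<Rightarrow> 'b::real_normed_vector"
  assumes "linear f"
  shows "norm (f u) \<le> (\<Sum>b\<in>B. norm (f b)) * norm u"
proof -
  have "norm (f u) \<le> (\<Sum>b\<in>B. norm ((u \<bullet> b) *\<^sub>R f b))"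
    by (subst linear_expansion[OF assms, of u]) (rule norm_sum)
  also have "\<dots> \<le> (\<Sum>b\<in>B. norm u * norm (f b))"
    by (intro sum_mono) (auto simp: abs_inner_le_norm norm_basis intro!: mult_right_mono)
  finally show ?thesis by (simp add: sum_distrib_left mult.commute)
qed

lemma bilinear_bound:
  fixes f :: "'e \<Rightarrow> 'e \<Rightarrow> 'b::real_normed_vector"
  assumes "bilinear f"
  shows "norm (f u v) \<le> (\<Sum>b\<in>B. \<Sum>c\<in>B. norm (f b c)) * norm u * norm v"
proof -
  have l: "linear (f x)" "linear (\<lambda>x. f x y)" for x y using assms by (auto simp: bilinear_def)
  have "norm (f u v) \<le> (\<Sum>b\<in>B. norm (f b v)) * norm u" by (rule linear_bound[OF l(2)])
  also have "\<dots> \<le> (\<Sum>b\<in>B. (\<Sum>c\<in>B. norm (f b c)) * norm v) * norm u"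
    by (intro mult_right_mono sum_mono linear_bound l) auto
  finally show ?thesis by (simp add: sum_distrib_left mult_ac)
qed

text \<open>The library proves compactness only for \<open>euclidean_space\<close>, which excludes dimension \<open>0\<close>.\<close>

lemma compact_unit_sphere: "compact (sphere (0::'e) 1)"
proof -
  \<comment> \<open>Coordinate cubes are compact by induction on the generating set, as Minkowski
    sums of segments. The unit sphere is a closed subset of the cube over \<open>B\<close>.\<close>
  define box where "box C = {\<Sum>b\<in>C. a b *\<^sub>R b | a. \<forall>b\<in>C. a b \<in> {-1..1::real}}" for C :: "'e set"
  have "compact (box C)" if "finite C" for C
    using that
  proof induction
    case empty
    then show ?case by (simp add: box_def)
  next
    case (insert x C)
    have "compact ((\<lambda>s. s *\<^sub>R x) ` {-1..1::real})"
      by (intro compact_continuous_image continuous_intros) auto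
    from compact_sums[OF this insert.IH]
    have "compact {p + q |p q. p \<in> (\<lambda>s. s *\<^sub>R x) ` {-1..1} \<and> q \<in> box C}" .
    moreover have "{p + q |p q. p \<in> (\<lambda>s. s *\<^sub>R x) ` {-1..1} \<and> q \<in> box C} = box (insert x C)"
    proof (intro equalityI subsetI)
      fix z assume "z \<in> {p + q |p q. p \<in> (\<lambda>s. s *\<^sub>R x) ` {-1..1} \<and> q \<in> box C}"
      then obtain s a where s: "s \<in> {-1..1}" "\<forall>b\<in>C. a b \<in> {-1..1}"
          and z: "z = s *\<^sub>R x + (\<Sum>b\<in>C. a b *\<^sub>R b)"
        unfolding box_def by blast
      have "(\<Sum>b\<in>C. (a(x := s)) b *\<^sub>R b) = (\<Sum>b\<in>C. a b *\<^sub>R b)"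
        using insert.hyps by (intro sum.cong) auto
      then have "z = (\<Sum>b\<in>insert x C. (a(x := s)) b *\<^sub>R b)"
        using insert.hyps z by simp
      moreover have "\<forall>b\<in>insert x C. (a(x := s)) b \<in> {-1..1}" using s by auto
      ultimately show "z \<in> box (insert x C)" unfolding box_def by blast
    next
      fix z assume "z \<in> box (insert x C)"
      then obtain a where a: "\<forall>b\<in>insert x C. a b \<in> {-1..1}"
          and z: "z = (\<Sum>b\<in>insert x C. a b *\<^sub>R b)"
        unfolding box_def by blast
      have "(\<Sum>b\<in>C. a b *\<^sub>R b) \<in> box C" and "a x *\<^sub>R x \<in> (\<lambda>s. s *\<^sub>R x) ` {-1..1}"
        using a unfolding box_def by auto
      then show "z \<in> {p + q |p q. p \<in> (\<lambda>s. s *\<^sub>R x) ` {-1..1} \<and> q \<in> box C}"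
        using insert.hyps z by auto
    qed
    ultimately show ?case by simp
  qed
  moreover have "closed (sphere (0::'e) 1)"
    unfolding sphere_def by (intro closed_Collect_eq continuous_intros)
  ultimately have "compact (sphere 0 1 \<inter> box B)"
    using finite_basis by (intro closed_Int_compact) auto
  moreover have "sphere 0 1 \<subseteq> box B"
  proof
    fix u :: 'e assume "u \<in> sphere 0 1"
    then have "\<forall>b\<in>B. u \<bullet> b \<in> {-1..1}"
      using abs_inner_le_norm[OF norm_basis, of _ u] by (auto simp: abs_le_iff)
    then show "u \<in> box B" unfolding box_def using basis_expansion[of u] by blast
  qed
  ultimately show ?thesis by (simp add: Int_absorb2)
qed

section \<open>Positive definite forms: coercivity and representation of functionals\<close>

lemma positive_form_coercive:
  assumes bil: "bilinear h" and pos: "\<And>u. u \<noteq> 0 \<Longrightarrow> 0 < h u u"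
  obtains k :: real where "0 < k" and "\<And>u. k * (norm u)\<^sup>2 \<le> h u (u::'e)"
\<comment> \<open>In dimension 0 the sphere is empty and offers no minimum, but then every vector is
  0 and the constant 1 will do.\<close>
proof (cases "sphere (0::'e) 1 = {}")
  case True
  have zero: "u = 0" for u :: 'e
  proof (rule ccontr)
    assume "u \<noteq> 0"
    then have "u /\<^sub>R norm u \<in> sphere 0 1" by simp
    then show False using True by simp
  qed
  then have "1 * (norm u)\<^sup>2 \<le> h u u" for u
    unfolding zero[of u] by (simp add: bilinear_lzero[OF bil])
  then show ?thesis using that[of 1] by auto
next
  case False
  \<comment> \<open>In coordinates the quadratic form is a polynomial, which gives its
    continuity.\<close>
  have hu: "h u u = (\<Sum>b\<in>B. \<Sum>c\<in>B. (u \<bullet> b) * (u \<bullet> c) * h b c)" for u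
    using bil unfolding bilinear_def
    by (subst linear_expansion[of "\<lambda>x. h x u"], simp)
      (subst linear_expansion[of "h _"], simp, simp add: sum_distrib_left mult_ac)
  have "continuous_on (sphere 0 1) (\<lambda>u. h u u)"
    unfolding hu by (intro continuous_intros)
  \<comment> \<open>The constant is the minimum of the form on the unit sphere. Homogeneity of
    degree two carries the estimate to all vectors.\<close>
  from continuous_attains_inf[OF compact_unit_sphere False this]
  obtain w where w: "w \<in> sphere 0 1" "\<And>u. u \<in> sphere 0 1 \<Longrightarrow> h w w \<le> h u u" by auto
  have "h w w * (norm u)\<^sup>2 \<le> h u u" for u
  proof (cases "u = 0")
    case False
    then have "u /\<^sub>R norm u \<in> sphere 0 1" by simp
    from w(2)[OF this] have "h w w \<le> inverse (norm u) * (inverse (norm u) * h u u)"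
      by (simp add: bilinear_lmul[OF bil] bilinear_rmul[OF bil])
    then have "h w w * (norm u)\<^sup>2 \<le> (inverse (norm u) * (inverse (norm u) * h u u)) * (norm u)\<^sup>2"
      by (intro mult_right_mono) auto
    then show ?thesis using False by (simp add: field_simps power2_eq_square)
  qed (simp add: bilinear_lzero[OF bil])
  moreover have "0 < h w w" using w(1) by (intro pos) auto
  ultimately show ?thesis using that by blast
qed

text \<open>The linear map \<open>T\<close>, whose value at \<open>z\<close> has the coordinates
  \<open>h z b\<close>, is injective by definiteness, hence surjective in finite dimension. A
  preimage of the coordinate vector of \<open>F\<close> represents \<open>F\<close>. This supplies
  the existence of the Christoffel symbols.\<close>

lemma riesz_representation:
  fixes h :: "'e \<Rightarrow> 'e \<Rightarrow> real"
  assumes bil: "bilinear h" and pos: "\<And>u. u \<noteq> 0 \<Longrightarrow> 0 < h u u" and F: "linear F"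
  obtains z where "\<And>w. h z w = F w"
proof -
  have independent: "independent B"
    using norm_basis by (intro pairwise_orthogonal_independent orthogonal_basis) force
  interpret V: finite_dimensional_vector_space_pair
    "(*\<^sub>R) :: real \<Rightarrow> 'e \<Rightarrow> 'e" B "(*\<^sub>R) :: real \<Rightarrow> 'e \<Rightarrow> 'e" B
    using finite_basis independent span_basis
    by unfold_locales (auto simp: algebra_simps dependent_raw_def span_raw_def)
  define T where "T z = (\<Sum>b\<in>B. h z b *\<^sub>R b)" for z
  have T_inner: "T z \<bullet> c = h z c" if "c \<in> B" for z c
  proof -
    have "T z \<bullet> c = (\<Sum>b\<in>B. if b = c then h z c else 0)"
      unfolding T_def inner_sum_left using that by (intro sum.cong) (auto simp: inner_basis)
    then show ?thesis using that finite_basis by simp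
  qed
  have lin: "linear (h u)" for u using bil by (simp add: bilinear_def)
  have "linear T"
    unfolding T_def
    by (rule linearI)
      (simp_all add: bilinear_ladd[OF bil] bilinear_lmul[OF bil] algebra_simps sum.distrib scaleR_sum_right)
  moreover have "inj T"
    unfolding linear_injective_0[OF \<open>linear T\<close>]
  proof (intro allI impI)
    fix z assume "T z = 0"
    then have "h z b = 0" if "b \<in> B" for b using T_inner[OF that, of z] by simp
    then have "h z z = 0" by (subst linear_expansion[OF lin]) simp
    then show "z = 0" using pos[of z] by force
  qed
  ultimately have "surj T"
    using V.linear_injective_imp_surjective[of T] by (simp add: linear_def)
  then obtain z where z: "T z = (\<Sum>b\<in>B. F b *\<^sub>R b)" by (metis surjD)
  have "h z c = F c" if "c \<in> B" for c
  proof -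
    have "h z c = (\<Sum>b\<in>B. F b *\<^sub>R b) \<bullet> c" using T_inner[OF that, of z] z by (simp only:)
    also have "\<dots> = (\<Sum>b\<in>B. if b = c then F c else 0)"
      unfolding inner_sum_left using that by (intro sum.cong) (auto simp: inner_basis)
    finally show ?thesis using that finite_basis by simp
  qed
  then have "h z w = F w" for w
    by (simp add: linear_expansion[OF lin, of z w] linear_expansion[OF F, of w])
  then show ?thesis by (rule that)
qed

end

text \<open>Orthogonalise the spanning set, discard a possible zero vector and normalise the
  rest.\<close>

lemma finite_orthonormal_basis_exists:
  fixes C :: "'e::real_inner set"
  assumes "finite C" and "span C = UNIV"
  obtains B :: "'e set" where "finite_orthonormal_basis B"
proof -
  obtain E where E: "finite E" "span E = (UNIV :: 'e set)" "pairwise orthogonal E"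
    using basis_orthogonal[OF assms(1)] assms(2) by auto
  define B where "B = (\<lambda>b. b /\<^sub>R norm b) ` (E - {0})"
  have "span B = UNIV"
  proof -
    have "e \<in> span B" if "e \<in> E" for e
    proof (cases "e = 0")
      case False
      then have "norm e *\<^sub>R (e /\<^sub>R norm e) \<in> span B"
        using that by (intro span_mul span_base) (auto simp: B_def)
      then show ?thesis using False by simp
    qed (simp add: span_zero)
    then show ?thesis using span_minimal[of E "span B"] E(2) by auto
  qed
  moreover have "pairwise orthogonal B"
    using E(3) unfolding B_def pairwise_def by (auto simp: orthogonal_def)
  ultimately have "finite_orthonormal_basis B"
    using E(1) by unfold_locales (auto simp: B_def inverse_eq_divide split: if_splits)
  then show ?thesis by (rule that)
qed

section \<open>Local Lipschitz continuity\<close>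

lemma isCont_tendsto_nhds: "isCont f x \<Longrightarrow> (f \<longlongrightarrow> f x) (nhds x)"
  by (simp add: continuous_at tendsto_at_iff_tendsto_nhds)

text \<open>Lipschitz continuity on some neighbourhood of \<open>x\<close>. The filter at the
  diagonal point \<open>(x, x)\<close> lets both points vary independently and combines finitely
  many estimates without bookkeeping of radii.\<close>

definition loc_lip :: "('a::real_normed_vector \<Rightarrow> 'b::real_normed_vector) \<Rightarrow> 'a \<Rightarrow> bool" where
  "loc_lip f x \<longleftrightarrow>
     (\<exists>L. \<forall>\<^sub>F (a, b) in nhds (x, x). norm (f a - f b) \<le> L * norm (a - b))"

lemma eventually_nhds_fst:
  assumes "eventually P (nhds x)"
  shows "\<forall>\<^sub>F (a, b) in nhds (x, y). P a"
proof -
  have "(fst \<longlongrightarrow> fst (x, y)) (nhds (x, y))"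
    by (intro tendsto_intros filterlim_ident)
  then show ?thesis using assms unfolding filterlim_iff case_prod_beta fst_conv snd_conv by blast
qed

lemma eventually_nhds_snd:
  assumes "eventually P (nhds y)"
  shows "\<forall>\<^sub>F (a, b) in nhds (x, y). P b"
proof -
  have "(snd \<longlongrightarrow> snd (x, y)) (nhds (x, y))"
    by (intro tendsto_intros filterlim_ident)
  then show ?thesis using assms unfolding filterlim_iff case_prod_beta fst_conv snd_conv by blast
qed

lemma loc_lip_add:
  assumes "loc_lip f x" and "loc_lip h x"
  shows "loc_lip (\<lambda>y. f y + h y) x"
proof -
  obtain L M where "\<forall>\<^sub>F (a, b) in nhds (x, x). norm (f a - f b) \<le> L * norm (a - b)"
    and "\<forall>\<^sub>F (a, b) in nhds (x, x). norm (h a - h b) \<le> M * norm (a - b)"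
    using assms unfolding loc_lip_def by auto
  then have "\<forall>\<^sub>F (a, b) in nhds (x, x). norm ((f a + h a) - (f b + h b)) \<le> (L + M) * norm (a - b)"
  proof eventually_elim
    case (elim p)
    then show ?case
      using norm_triangle_ineq[of "f (fst p) - f (snd p)" "h (fst p) - h (snd p)"]
      by (auto simp: case_prod_beta algebra_simps)
  qed
  then show ?thesis unfolding loc_lip_def by blast
qed

lemma loc_lip_scaleR:
  assumes "loc_lip f x"
  shows "loc_lip (\<lambda>y. c *\<^sub>R f y) x"
proof -
  obtain L where "\<forall>\<^sub>F (a, b) in nhds (x, x). norm (f a - f b) \<le> L * norm (a - b)"
    using assms unfolding loc_lip_def by auto
  then have "\<forall>\<^sub>F (a, b) in nhds (x, x). norm (c *\<^sub>R f a - c *\<^sub>R f b) \<le> (\<bar>c\<bar> * L) * norm (a - b)"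
  proof eventually_elim
    case (elim p)
    then show ?case
      by (auto simp: case_prod_beta mult.assoc mult_left_mono simp flip: scaleR_diff_right)
  qed
  then show ?thesis unfolding loc_lip_def by blast
qed

text \<open>The sum of the absolute values of the individual constants serves the whole family and
  is nonnegative.\<close>

lemma loc_lip_finite:
  assumes "finite I" and "\<And>i. i \<in> I \<Longrightarrow> loc_lip (f i) x"
  obtains L where "0 \<le> L"
    and "\<forall>\<^sub>F (a, b) in nhds (x, x). \<forall>i\<in>I. norm (f i a - f i b) \<le> L * norm (a - b)"
proof -
  have "\<exists>l. \<forall>\<^sub>F p in nhds (x, x). norm (f i (fst p) - f i (snd p)) \<le> l * norm (fst p - snd p)"
    if "i \<in> I" for i
    using assms(2)[OF that] unfolding loc_lip_def case_prod_beta .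
  then have "\<exists>l. \<forall>i\<in>I.
      \<forall>\<^sub>F p in nhds (x, x). norm (f i (fst p) - f i (snd p)) \<le> l i * norm (fst p - snd p)"
    by (intro bchoice ballI)
  then obtain l where l: "\<forall>i\<in>I.
      \<forall>\<^sub>F p in nhds (x, x). norm (f i (fst p) - f i (snd p)) \<le> l i * norm (fst p - snd p)" ..
  define L where "L = (\<Sum>i\<in>I. \<bar>l i\<bar>)"
  have le: "l i \<le> L" if "i \<in> I" for i
    using member_le_sum[of i I "\<lambda>i. \<bar>l i\<bar>"] that assms(1) unfolding L_def by force
  have "\<forall>\<^sub>F p in nhds (x, x). \<forall>i\<in>I. norm (f i (fst p) - f i (snd p)) \<le> l i * norm (fst p - snd p)"
    using assms(1) l by (intro eventually_ball_finite) blast+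
  then have "\<forall>\<^sub>F p in nhds (x, x). \<forall>i\<in>I. norm (f i (fst p) - f i (snd p)) \<le> L * norm (fst p - snd p)"
    by (rule eventually_mono)
      (meson le mult_right_mono norm_ge_zero order_trans)
  then have "\<forall>\<^sub>F (a, b) in nhds (x, x). \<forall>i\<in>I. norm (f i a - f i b) \<le> L * norm (a - b)"
    unfolding case_prod_beta .
  moreover have "0 \<le> L" by (simp add: L_def sum_nonneg)
  ultimately show ?thesis using that by blast
qed

context finite_orthonormal_basis
begin

text \<open>Mean value inequality on a ball. Continuity of the derivative is available only for each
  fixed direction, as in \<open>Ck_on\<close>; bounds in the finitely many basis directions already
  bound its operator norm near \<open>x\<close>.\<close>

lemma bounded_partials_imp_loc_lip:
  fixes f :: "'e \<Rightarrow> 'b::real_normed_vector"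
  assumes S: "open S" "x \<in> S"
    and diff: "\<And>y. y \<in> S \<Longrightarrow> f differentiable (at y)"
    and cont: "\<And>v. continuous_on S (\<lambda>y. frechet_derivative f (at y) v)"
  shows "loc_lip f x"
proof -
  define D where "D y = frechet_derivative f (at y)" for y
  \<comment> \<open>The \<open>+ 1\<close> leaves room above the value at \<open>x\<close>, so that
    continuity keeps the nearby values below it.\<close>
  define L where "L = (\<Sum>b\<in>B. norm (D x b) + 1)"
  have "\<forall>\<^sub>F y in nhds x. norm (D y b) < norm (D x b) + 1" for b
  proof -
    have "continuous (at x) (\<lambda>y. norm (D y b))"
      using cont S unfolding D_def by (intro continuous_intros) (simp add: continuous_on_eq_continuous_at)
    then have "((\<lambda>y. norm (D y b)) \<longlongrightarrow> norm (D x b)) (nhds x)"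
      by (rule isCont_tendsto_nhds)
    then show ?thesis by (rule order_tendstoD) simp
  qed
  then have "\<forall>\<^sub>F y in nhds x. y \<in> S \<and> (\<forall>b\<in>B. norm (D y b) < norm (D x b) + 1)"
    using finite_basis S by (intro eventually_conj eventually_ball_finite) (auto intro: eventually_nhds_in_open)
  then obtain r where r: "r > 0" "\<And>y. y \<in> ball x r \<Longrightarrow> y \<in> S"
      "\<And>y b. y \<in> ball x r \<Longrightarrow> b \<in> B \<Longrightarrow> norm (D y b) < norm (D x b) + 1"
    unfolding eventually_nhds_metric by (metis mem_ball dist_commute)
  have der: "(f has_derivative D y) (at y)" if "y \<in> S" for y
    using diff[OF that] unfolding D_def by (simp add: frechet_derivative_works)
  have bound: "norm (f a - f b) \<le> L * norm (a - b)" if "a \<in> ball x r" "b \<in> ball x r" for a b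
  proof (rule differentiable_bound[of "ball x r" f D])
    fix y assume y: "y \<in> ball x r"
    then show "(f has_derivative D y) (at y within ball x r)"
      using der r(2) has_derivative_at_withinI by blast
    have "linear (D y)" using der[OF r(2)[OF y]] by (rule has_derivative_linear)
    show "onorm (D y) \<le> L"
    proof (rule onorm_bound)
      show "0 \<le> L" by (simp add: L_def sum_nonneg)
      fix h
      have "norm (D y h) \<le> (\<Sum>b\<in>B. norm (D y b)) * norm h"
        by (rule linear_bound) fact
      also have "\<dots> \<le> L * norm h"
        unfolding L_def using r(3)[OF y] by (intro mult_right_mono sum_mono) (auto intro: less_imp_le)
      finally show "norm (D y h) \<le> L * norm h" .
    qed
  qed (use that in auto)
  have near: "\<forall>\<^sub>F y in nhds x. y \<in> ball x r"
    using \<open>r > 0\<close> by (intro eventually_nhds_in_open) auto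
  from eventually_nhds_fst[OF near] eventually_nhds_snd[OF near]
  have "\<forall>\<^sub>F (a, b) in nhds (x, x). norm (f a - f b) \<le> L * norm (a - b)"
  proof eventually_elim
    case (elim i)
    then show ?case using bound by (cases i) auto
  qed
  then show ?thesis unfolding loc_lip_def by blast
qed

end

lemma loc_lip_tendsto:
  assumes "loc_lip f x"
  shows "(f \<longlongrightarrow> f x) (nhds x)"
proof -
  obtain L where L: "\<forall>\<^sub>F p in nhds (x, x). norm (f (fst p) - f (snd p)) \<le> L * norm (fst p - snd p)"
    using assms unfolding loc_lip_def case_prod_beta by auto
  have "((\<lambda>y. (y, x)) \<longlongrightarrow> (x, x)) (nhds x)"
    by (intro tendsto_intros filterlim_ident)
  from filterlim_iff[THEN iffD1, OF this, rule_format, OF L]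
  have "\<forall>\<^sub>F y in nhds x. norm (f y - f x) \<le> L * norm (y - x)" by simp
  moreover have "((\<lambda>y. L * norm (y - x)) \<longlongrightarrow> L * norm (x - x)) (nhds x)"
    by (intro tendsto_mult tendsto_norm tendsto_diff tendsto_const filterlim_ident)
  ultimately have "((\<lambda>y. f y - f x) \<longlongrightarrow> 0) (nhds x)"
    by (simp add: Lim_null_comparison)
  then show ?thesis by (rule LIM_zero_cancel)
qed

lemma bilinear_diff:
  "bilinear f \<Longrightarrow> bilinear h \<Longrightarrow> bilinear (\<lambda>u v. f u v - h u v)"
  unfolding bilinear_def by (auto intro: linear_compose_sub)

text \<open>The bound on \<open>\<delta>'\<close> makes \<open>\<delta> t * exp (- K * t)\<close>
  nonincreasing to the right of \<open>t0\<close> and \<open>\<delta> t * exp (K * t)\<close>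
  nondecreasing to the left of it. Both are nonnegative and vanish at \<open>t0\<close>, so they
  vanish nearby.\<close>

lemma gronwall_zero:
  fixes \<delta> :: "real \<Rightarrow> real"
  assumes nonneg: "\<And>t. 0 \<le> \<delta> t" and zero: "\<delta> t0 = 0"
    and der: "\<forall>\<^sub>F t in nhds t0. (\<delta> has_real_derivative \<delta>' t) (at t) \<and> \<bar>\<delta>' t\<bar> \<le> K * \<delta> t"
  shows "\<forall>\<^sub>F t in nhds t0. \<delta> t = 0"
proof -
  obtain r where "r > 0" and r: "\<And>t. \<bar>t - t0\<bar> < r \<Longrightarrow> (\<delta> has_real_derivative \<delta>' t) (at t)"
      "\<And>t. \<bar>t - t0\<bar> < r \<Longrightarrow> \<bar>\<delta>' t\<bar> \<le> K * \<delta> t"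
    using der unfolding eventually_nhds_metric dist_real_def by blast
  have h: "((\<lambda>t. \<delta> t * exp (c * t)) has_real_derivative (\<delta>' t + c * \<delta> t) * exp (c * t)) (at t)"
    if "\<bar>t - t0\<bar> < r" for t c
    by (rule derivative_eq_intros r(1) that refl | simp add: algebra_simps)+
  have "\<delta> t = 0" if t: "\<bar>t - t0\<bar> < r" for t
  proof (cases "t0 \<le> t")
    case True
    have "\<delta> t * exp (- K * t) \<le> \<delta> t0 * exp (- K * t0)"
    proof (rule DERIV_nonpos_imp_nonincreasing[OF True], intro exI conjI)
      fix s assume s: "t0 \<le> s" "s \<le> t"
      show "((\<lambda>t. \<delta> t * exp (- K * t)) has_real_derivative (\<delta>' s + - K * \<delta> s) * exp (- K * s)) (at s)"
        by (rule h) (use s t in auto)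
      show "(\<delta>' s + - K * \<delta> s) * exp (- K * s) \<le> 0"
        using r(2)[of s] s t by (intro mult_nonpos_nonneg) auto
    qed
    then show ?thesis using nonneg[of t] zero by (simp add: mult_le_0_iff)
  next
    case False
    then have le: "t \<le> t0" by simp
    have "\<delta> t * exp (K * t) \<le> \<delta> t0 * exp (K * t0)"
    proof (rule DERIV_nonneg_imp_nondecreasing[OF le], intro exI conjI)
      fix s assume s: "t \<le> s" "s \<le> t0"
      show "((\<lambda>t. \<delta> t * exp (K * t)) has_real_derivative (\<delta>' s + K * \<delta> s) * exp (K * s)) (at s)"
        by (rule h) (use s t in auto)
      show "0 \<le> (\<delta>' s + K * \<delta> s) * exp (K * s)"
        using r(2)[of s] s t by (intro mult_nonneg_nonneg) auto
    qed
    then show ?thesis using nonneg[of t] zero by (simp add: mult_le_0_iff)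
  qed
  then show ?thesis using \<open>r > 0\<close> unfolding eventually_nhds_metric dist_real_def by blast
qed

section \<open>Christoffel symbols and the geodesic equation\<close>

text \<open>A Riemannian metric seen in one chart: \<open>S\<close> is the image of the chart and
  \<open>G\<close> the coordinate expression of the metric. The analysis of the geodesic equation
  takes place on this open subset of the model space.\<close>

locale metric_field = finite_orthonormal_basis B for B :: "'e::real_inner set" +
  fixes S :: "'e set" and G :: "'e \<Rightarrow> 'e \<Rightarrow> 'e \<Rightarrow> real"
  assumes open_domain: "open S"
    and bilinear_metric: "y \<in> S \<Longrightarrow> bilinear (G y)"
    and metric_pos: "y \<in> S \<Longrightarrow> u \<noteq> 0 \<Longrightarrow> 0 < G y u u"
    and smooth_metric: "smooth_on S (\<lambda>y. G y u v)"
begin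

section \<open>Derivatives of the metric and the Koszul formula\<close>

definition dG :: "'e \<Rightarrow> 'e \<Rightarrow> 'e \<Rightarrow> 'e \<Rightarrow> real" where
  "dG y u v w = frechet_derivative (\<lambda>p. G p u v) (at y) w"

text \<open>Right-hand side of the Koszul formula for constant fields, that is, twice the metric
  product of the Christoffel vector with \<open>w\<close>. It involves derivatives of the metric but
  no inverse of it.\<close>

definition koszul :: "'e \<Rightarrow> 'e \<Rightarrow> 'e \<Rightarrow> 'e \<Rightarrow> real" where
  "koszul y u v w = dG y v w u + dG y u w v - dG y u v w"

lemma has_derivative_metric: "y \<in> S \<Longrightarrow> ((\<lambda>p. G p u v) has_derivative dG y u v) (at y)"
  using smooth_metric[of u v, unfolded smooth_on_def, rule_format, of 1]
  by (auto simp: frechet_derivative_works dG_def[abs_def])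

lemma metric_loc_lip: "y \<in> S \<Longrightarrow> loc_lip (\<lambda>p. G p u v) y"
  using smooth_metric[of u v, unfolded smooth_on_def, rule_format, of 1]
  by (intro bounded_partials_imp_loc_lip[of S] open_domain) auto

text \<open>Here \<open>dG\<close> itself has to be continuously differentiable in the point, so the
  metric is used up to order 2.\<close>

lemma dG_loc_lip: "y \<in> S \<Longrightarrow> loc_lip (\<lambda>p. dG p u v w) y"
  using smooth_metric[of u v, unfolded smooth_on_def, rule_format, of 2] unfolding dG_def
  by (intro bounded_partials_imp_loc_lip[of S] open_domain) (auto simp: numeral_2_eq_2)

lemma koszul_loc_lip: "y \<in> S \<Longrightarrow> loc_lip (\<lambda>p. koszul p u v w) y"
  using loc_lip_add[OF loc_lip_add[OF dG_loc_lip dG_loc_lip]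
      loc_lip_scaleR[OF dG_loc_lip, of _ "-1"], of y v w u u w v u v w]
  by (simp add: koszul_def)

lemma dG_unique: "y \<in> S \<Longrightarrow> ((\<lambda>p. G p u v) has_derivative F) (at y) \<Longrightarrow> dG y u v = F"
  using has_derivative_unique[OF has_derivative_metric] by blast

lemma dG_linear: "y \<in> S \<Longrightarrow> linear (dG y u v)"
  by (rule has_derivative_linear[OF has_derivative_metric])

text \<open>Bilinearity of the metric holds throughout the open set \<open>S\<close>, hence as an
  identity between functions, and can be differentiated. One statement serves both slots of the
  metric.\<close>

lemma dG_combine:
  assumes "y \<in> S" and "\<And>p. p \<in> S \<Longrightarrow> G p u v = a * G p u' v' + b * G p u'' v''"
  shows "dG y u v w = a * dG y u' v' w + b * dG y u'' v'' w"
proof -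
  have "((\<lambda>p. a * G p u' v' + b * G p u'' v'') has_derivative
      (\<lambda>w. a * dG y u' v' w + b * dG y u'' v'' w)) (at y)"
    by (intro derivative_intros has_derivative_metric assms(1))
  then have "((\<lambda>p. G p u v) has_derivative (\<lambda>w. a * dG y u' v' w + b * dG y u'' v'' w)) (at y)"
    by (rule has_derivative_transform_within_open[OF _ open_domain assms(1)]) (simp add: assms(2))
  from dG_unique[OF assms(1) this] show ?thesis by simp
qed

lemma dG_left: "y \<in> S \<Longrightarrow> dG y (a *\<^sub>R u + b *\<^sub>R v) z w = a * dG y u z w + b * dG y v z w"
  by (rule dG_combine) (auto simp: bilinear_ladd bilinear_lmul bilinear_metric)

lemma dG_right: "y \<in> S \<Longrightarrow> dG y z (a *\<^sub>R u + b *\<^sub>R v) w = a * dG y z u w + b * dG y z v w"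
  by (rule dG_combine) (auto simp: bilinear_radd bilinear_rmul bilinear_metric)

lemma dG_arg: "y \<in> S \<Longrightarrow> dG y u v (a *\<^sub>R w + b *\<^sub>R z) = a * dG y u v w + b * dG y u v z"
  by (simp add: linear_add linear_cmul dG_linear)

lemma koszul_left:
  "y \<in> S \<Longrightarrow> koszul y (a *\<^sub>R u + b *\<^sub>R v) z w = a * koszul y u z w + b * koszul y v z w"
  by (simp add: koszul_def dG_left dG_right dG_arg algebra_simps)

lemma koszul_right:
  "y \<in> S \<Longrightarrow> koszul y z (a *\<^sub>R u + b *\<^sub>R v) w = a * koszul y z u w + b * koszul y z v w"
  by (simp add: koszul_def dG_left dG_right dG_arg algebra_simps)

lemma koszul_linear:
  assumes "y \<in> S"
  shows "linear (koszul y u v)"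
proof (rule linearI)
  note dG = dG_left[OF assms] dG_right[OF assms] dG_arg[OF assms]
  show "koszul y u v (w + z) = koszul y u v w + koszul y u v z" for w z
    using dG(1)[of 1 w 1 z] dG(2)[of _ 1 w 1 z] dG(3)[of _ _ 1 w 1 z] by (simp add: koszul_def)
  show "koszul y u v (c *\<^sub>R w) = c *\<^sub>R koszul y u v w" for c w
    using dG(1)[of c w 0 0] dG(2)[of _ c w 0 0] dG(3)[of _ _ c w 0 0]
    by (simp add: koszul_def right_diff_distrib distrib_left)
qed

lemma metric_eqI: "y \<in> S \<Longrightarrow> (\<And>w. G y z w = G y z' w) \<Longrightarrow> z = z'"
proof (rule ccontr)
  assume y: "y \<in> S" and eq: "\<And>w. G y z w = G y z' w" and "z \<noteq> z'"
  then have "0 < G y (z - z') (z - z')" by (intro metric_pos) auto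
  then show False using eq by (simp add: bilinear_lsub[OF bilinear_metric[OF y]])
qed

text \<open>Riesz representation of \<open>koszul y u v\<close> gives existence and definiteness of
  the metric gives uniqueness, so the definite description is meaningful. Later arguments work with
  this equation instead of the description.\<close>

lemma christoffel_koszul:
  assumes "y \<in> S"
  shows "2 * G y (christoffel G y u v) w = koszul y u v w"
proof -
  obtain z where z: "\<And>w. G y z w = koszul y u v w"
    using riesz_representation[OF bilinear_metric[OF assms] metric_pos[OF assms]
          koszul_linear[OF assms, of u v]] by blast
  have "\<forall>w. 2 * G y (christoffel G y u v) w =
     frechet_derivative (\<lambda>p. G p v w) (at y) u
     + frechet_derivative (\<lambda>p. G p u w) (at y) v
     - frechet_derivative (\<lambda>p. G p u v) (at y) w"
    unfolding christoffel_def
  proof (rule theI)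
    \<comment> \<open>\<open>z\<close> represents the full Koszul expression; the factor 1/2
      compensates for the 2 on the left.\<close>
    show *: "\<forall>w. 2 * G y ((1/2) *\<^sub>R z) w =
     frechet_derivative (\<lambda>p. G p v w) (at y) u
     + frechet_derivative (\<lambda>p. G p u w) (at y) v
     - frechet_derivative (\<lambda>p. G p u v) (at y) w"
      using z unfolding koszul_def dG_def
      by (simp add: bilinear_lmul[OF bilinear_metric[OF assms]])
    fix z' assume "\<forall>w. 2 * G y z' w =
     frechet_derivative (\<lambda>p. G p v w) (at y) u
     + frechet_derivative (\<lambda>p. G p u w) (at y) v
     - frechet_derivative (\<lambda>p. G p u v) (at y) w"
    with * have "G y z' w = G y ((1/2) *\<^sub>R z) w" for w
      by (metis mult_left_cancel zero_neq_numeral)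
    then show "z' = (1/2) *\<^sub>R z" by (rule metric_eqI[OF assms])
  qed
  then show ?thesis by (simp add: koszul_def dG_def)
qed

lemma christoffel_unique:
  "y \<in> S \<Longrightarrow> (\<And>w. 2 * G y z w = koszul y u v w) \<Longrightarrow> christoffel G y u v = z"
  by (rule metric_eqI[of y]) (simp_all flip: christoffel_koszul)

text \<open>The combination of Christoffel vectors solves the Koszul equation of the combined
  arguments, and uniqueness identifies the two.\<close>

lemma bilinear_christoffel:
  assumes "y \<in> S"
  shows "bilinear (christoffel G y)"
proof -
  note bil = bilinear_metric[OF assms]
  have l: "christoffel G y (a *\<^sub>R u + b *\<^sub>R v) z = a *\<^sub>R christoffel G y u z + b *\<^sub>R christoffel G y v z" for a b u v z
    by (rule christoffel_unique[OF assms])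
      (simp add: bilinear_ladd[OF bil] bilinear_lmul[OF bil] koszul_left[OF assms] distrib_left
        mult.left_commute[of 2] christoffel_koszul[OF assms])
  have r: "christoffel G y z (a *\<^sub>R u + b *\<^sub>R v) = a *\<^sub>R christoffel G y z u + b *\<^sub>R christoffel G y z v" for a b u v z
    by (rule christoffel_unique[OF assms])
      (simp add: bilinear_ladd[OF bil] bilinear_lmul[OF bil] koszul_right[OF assms] distrib_left
        mult.left_commute[of 2] christoffel_koszul[OF assms])
  show ?thesis
    unfolding bilinear_def
  proof (intro conjI allI linearI)
    show "christoffel G y u (v + z) = christoffel G y u v + christoffel G y u z"
      "christoffel G y (v + z) u = christoffel G y v u + christoffel G y z u" for u v z
      using l[of 1 v 1 z u] r[of u 1 v 1 z] by simp_all
    show "christoffel G y u (c *\<^sub>R v) = c *\<^sub>R christoffel G y u v"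
      "christoffel G y (c *\<^sub>R v) u = c *\<^sub>R christoffel G y v u" for c u v
      using l[of c v 0 0 u] r[of u c v 0 0] by simp_all
  qed
qed

section \<open>Local bounds and Lipschitz continuity of the Christoffel symbols\<close>

lemma metric_coercive_near:
  assumes "x \<in> S"
  obtains k where "0 < k" and "\<forall>\<^sub>F y in nhds x. y \<in> S \<and> (\<forall>u. k * (norm u)\<^sup>2 \<le> G y u u)"
proof -
  obtain k where "0 < k" and k: "\<And>u. k * (norm u)\<^sup>2 \<le> G x u u"
    using positive_form_coercive[OF bilinear_metric[OF assms] metric_pos[OF assms]] by metis
  have "((\<lambda>y. \<Sum>b\<in>B. \<Sum>c\<in>B. norm (G y b c - G x b c)) \<longlongrightarrow> (\<Sum>b\<in>B. \<Sum>c\<in>B. norm (G x b c - G x b c))) (nhds x)"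
    by (intro tendsto_sum tendsto_norm[OF tendsto_diff[OF loc_lip_tendsto[OF metric_loc_lip] tendsto_const]] assms)
  \<comment> \<open>Half of the coercivity constant at \<open>x\<close> is given up to absorb the
    change of the metric between \<open>x\<close> and \<open>y\<close>.\<close>
  then have "\<forall>\<^sub>F y in nhds x. (\<Sum>b\<in>B. \<Sum>c\<in>B. norm (G y b c - G x b c)) < k / 2"
    by (rule order_tendstoD) (use \<open>0 < k\<close> in simp)
  moreover have "\<forall>\<^sub>F y in nhds x. y \<in> S"
    using open_domain assms by (rule eventually_nhds_in_open)
  ultimately have "\<forall>\<^sub>F y in nhds x. y \<in> S \<and> (\<forall>u. k / 2 * (norm u)\<^sup>2 \<le> G y u u)"
  proof eventually_elim
    case (elim y)
    have "k / 2 * (norm u)\<^sup>2 \<le> G y u u" for u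
    proof -
      have "norm (G y u u - G x u u) \<le> (\<Sum>b\<in>B. \<Sum>c\<in>B. norm (G y b c - G x b c)) * norm u * norm u"
        by (rule bilinear_bound) (intro bilinear_diff bilinear_metric assms elim)
      also have "\<dots> \<le> k / 2 * norm u * norm u"
        using elim by (intro mult_right_mono) auto
      finally show ?thesis using k[of u] by (simp add: power2_eq_square abs_if split: if_splits)
    qed
    then show ?case using elim by blast
  qed
  then show ?thesis using that[of "k / 2"] \<open>0 < k\<close> by simp
qed

text \<open>The Koszul equation is tested against the Christoffel vector \<open>z\<close> itself:
  coercivity gives a quadratic lower bound in \<open>norm z\<close>, linearity of
  \<open>koszul\<close> a linear upper bound, and one factor \<open>norm z\<close> cancels.\<close>

lemma christoffel_bounded_near:
  assumes "x \<in> S"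
  obtains M where "0 \<le> M" and "\<forall>\<^sub>F y in nhds x. norm (christoffel G y u v) \<le> M"
proof -
  obtain k where "0 < k" and k: "\<forall>\<^sub>F y in nhds x. y \<in> S \<and> (\<forall>u. k * (norm u)\<^sup>2 \<le> G y u u)"
    using metric_coercive_near[OF assms] .
  define N where "N y = (\<Sum>b\<in>B. norm (koszul y u v b))" for y
  have "0 \<le> N x" by (simp add: N_def sum_nonneg)
  have "(N \<longlongrightarrow> N x) (nhds x)"
    unfolding N_def by (intro tendsto_sum tendsto_norm[OF loc_lip_tendsto[OF koszul_loc_lip]] assms)
  then have "\<forall>\<^sub>F y in nhds x. N y < N x + 1"
    by (rule order_tendstoD) simp
  with k have "\<forall>\<^sub>F y in nhds x. norm (christoffel G y u v) \<le> (N x + 1) / k"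
  proof eventually_elim
    case (elim y)
    define z where "z = christoffel G y u v"
    have "k * (norm z)\<^sup>2 \<le> G y z z" using elim by blast
    also have "2 * G y z z = koszul y u v z"
      unfolding z_def using elim by (intro christoffel_koszul) auto
    then have "G y z z \<le> norm (koszul y u v z)"
      by simp
    also have "\<dots> \<le> N y * norm z"
      unfolding N_def using elim by (intro linear_bound koszul_linear) auto
    also have "\<dots> \<le> (N x + 1) * norm z"
      using elim by (intro mult_right_mono) auto
    finally have "norm z * (k * norm z) \<le> norm z * (N x + 1)"
      by (simp add: power2_eq_square mult_ac)
    then have "k * norm z \<le> N x + 1"
      using \<open>0 \<le> N x\<close> by (cases "z = 0") auto
    then show ?case using \<open>0 < k\<close> by (simp add: z_def field_simps)
  qed
  moreover have "0 \<le> (N x + 1) / k" using \<open>0 \<le> N x\<close> \<open>0 < k\<close> by simp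
  ultimately show ?thesis using that by blast
qed

text \<open>Subtracting the Koszul equations at two points expresses the product of the difference
  \<open>w\<close> of the Christoffel vectors with \<open>w\<close> through differences of
  \<open>koszul\<close> and of the metric, both locally Lipschitz in the point. The local bound
  \<open>M\<close> controls the Christoffel vector that enters the second difference.\<close>

lemma christoffel_loc_lip:
  assumes "x \<in> S"
  shows "loc_lip (\<lambda>y. christoffel G y u v) x"
proof -
  define z where "z y = christoffel G y u v" for y
  obtain k where "0 < k" and k: "\<forall>\<^sub>F y in nhds x. y \<in> S \<and> (\<forall>u. k * (norm u)\<^sup>2 \<le> G y u u)"
    using metric_coercive_near[OF assms] .
  obtain M where "0 \<le> M" and M: "\<forall>\<^sub>F y in nhds x. norm (z y) \<le> M"
    using christoffel_bounded_near[OF assms] unfolding z_def .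
  obtain L where "0 \<le> L"
    and L: "\<forall>\<^sub>F (p, q) in nhds (x, x). \<forall>b\<in>B. norm (koszul p u v b - koszul q u v b) \<le> L * norm (p - q)"
    using loc_lip_finite[OF finite_basis koszul_loc_lip[OF assms]] .
  obtain L' where "0 \<le> L'"
    and L': "\<forall>\<^sub>F (p, q) in nhds (x, x). \<forall>i\<in>B \<times> B.
      norm (G p (fst i) (snd i) - G q (fst i) (snd i)) \<le> L' * norm (p - q)"
    using loc_lip_finite[OF finite_cartesian_product[OF finite_basis finite_basis] metric_loc_lip[OF assms]] .
  define n where "n = real (card B)"
  \<comment> \<open>The first term collects one sum over the basis for \<open>koszul\<close>, the
    second a double sum for the metric.\<close>
  define C where "C = n * L + n * n * L' * M"
  have "\<forall>\<^sub>F (p, q) in nhds (x, x). norm (z p - z q) \<le> C / k * norm (p - q)"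
    using L L' eventually_nhds_fst[OF k] eventually_nhds_snd[OF k] eventually_nhds_snd[OF M]
  proof eventually_elim
    case (elim i)
    obtain p q where i: "i = (p, q)" by (cases i)
    have S: "p \<in> S" "q \<in> S" using elim i by auto
    note bil = bilinear_metric[OF S(1)] bilinear_metric[OF S(2)]
    define w where "w = z p - z q"
    have "norm (koszul p u v w - koszul q u v w)
        \<le> (\<Sum>b\<in>B. norm (koszul p u v b - koszul q u v b)) * norm w"
      by (rule linear_bound) (intro linear_compose_sub koszul_linear S)
    also have "\<dots> \<le> (\<Sum>b\<in>B. L * norm (p - q)) * norm w"
      using elim i by (intro mult_right_mono sum_mono) auto
    finally have 1: "norm (koszul p u v w - koszul q u v w) \<le> n * L * norm (p - q) * norm w"
      by (simp add: n_def mult_ac)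
    have "norm (G p (z q) w - G q (z q) w)
        \<le> (\<Sum>b\<in>B. \<Sum>c\<in>B. norm (G p b c - G q b c)) * norm (z q) * norm w"
      by (rule bilinear_bound) (intro bilinear_diff bil)
    also have "\<dots> \<le> (\<Sum>b\<in>B. \<Sum>c\<in>B. L' * norm (p - q)) * M * norm w"
      using elim i \<open>0 \<le> M\<close> \<open>0 \<le> L'\<close> by (intro mult_right_mono mult_mono sum_mono sum_nonneg) auto
    finally have 2: "norm (G p (z q) w - G q (z q) w) \<le> n * n * L' * M * norm (p - q) * norm w"
      by (simp add: n_def mult_ac)
    \<comment> \<open>Testing against \<open>w\<close> itself turns coercivity into a bound on \<open>w\<close> without inverting \<open>G p\<close>.\<close>
    have "2 * G p w w = koszul p u v w - koszul q u v w - 2 * (G p (z q) w - G q (z q) w)"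
      unfolding christoffel_koszul[OF S(1), symmetric] christoffel_koszul[OF S(2), symmetric]
      unfolding z_def[symmetric] by (simp add: w_def bilinear_lsub[OF bil(1)])
    then have "G p w w \<le> norm (koszul p u v w - koszul q u v w) + norm (G p (z q) w - G q (z q) w)"
      by simp
    also have "\<dots> \<le> C * norm (p - q) * norm w"
      using 1 2 by (simp add: C_def algebra_simps)
    finally have "G p w w \<le> C * norm (p - q) * norm w" .
    moreover have "k * (norm w)\<^sup>2 \<le> G p w w" using elim i by auto
    ultimately have "norm w * (k * norm w) \<le> norm w * (C * norm (p - q))"
      by (simp add: power2_eq_square mult_ac)
    moreover have "0 \<le> C" using \<open>0 \<le> L\<close> \<open>0 \<le> L'\<close> \<open>0 \<le> M\<close> by (simp add: C_def n_def)
    ultimately have "k * norm w \<le> C * norm (p - q)"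
      by (cases "w = 0") auto
    then show ?case using \<open>0 < k\<close> i by (simp add: w_def field_simps)
  qed
  then show ?thesis unfolding loc_lip_def z_def by blast
qed

text \<open>Lipschitz estimate for the geodesic equation as a first-order system in position and
  velocity. Velocities are confined to a ball because the equation is quadratic in them.\<close>

lemma christoffel_quadratic_lip:
  assumes "x \<in> S" and "0 \<le> R"
  obtains C where "0 \<le> C" and "\<forall>\<^sub>F (a, b) in nhds (x, x). \<forall>p q. norm p \<le> R \<longrightarrow> norm q \<le> R \<longrightarrow>
    norm (christoffel G a p p - christoffel G b q q) \<le> C * (norm (a - b) + norm (p - q))"
proof -
  obtain L where "0 \<le> L"
    and L: "\<forall>\<^sub>F (p, q) in nhds (x, x). \<forall>i\<in>B \<times> B.
      norm (christoffel G p (fst i) (snd i) - christoffel G q (fst i) (snd i)) \<le> L * norm (p - q)"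
    using loc_lip_finite[OF finite_cartesian_product[OF finite_basis finite_basis]
        christoffel_loc_lip[OF assms(1)]] .
  define N where "N y = (\<Sum>b\<in>B. \<Sum>c\<in>B. norm (christoffel G y b c))" for y
  have "(N \<longlongrightarrow> N x) (nhds x)"
    unfolding N_def by (intro tendsto_sum tendsto_norm[OF loc_lip_tendsto[OF christoffel_loc_lip]] assms)
  then have N: "\<forall>\<^sub>F y in nhds x. N y < N x + 1"
    by (rule order_tendstoD) simp
  have "0 \<le> N x" by (simp add: N_def sum_nonneg)
  define n where "n = real (card B)"
  define C where "C = n * n * L * R * R + 2 * ((N x + 1) * R)"
  have "0 \<le> C" using \<open>0 \<le> L\<close> \<open>0 \<le> N x\<close> \<open>0 \<le> R\<close> by (simp add: C_def n_def)
  have in_S: "\<forall>\<^sub>F y in nhds x. y \<in> S"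
    using open_domain assms(1) by (rule eventually_nhds_in_open)
  have "\<forall>\<^sub>F (a, b) in nhds (x, x). \<forall>p q. norm p \<le> R \<longrightarrow> norm q \<le> R \<longrightarrow>
    norm (christoffel G a p p - christoffel G b q q) \<le> C * (norm (a - b) + norm (p - q))"
    using L eventually_nhds_snd[OF N] eventually_nhds_fst[OF in_S] eventually_nhds_snd[OF in_S]
  proof eventually_elim
    case (elim i)
    obtain a b where i: "i = (a, b)" by (cases i)
    have S: "a \<in> S" "b \<in> S" using elim i by auto
    note bil = bilinear_christoffel[OF S(1)] bilinear_christoffel[OF S(2)]
    have "norm (christoffel G a p p - christoffel G b q q) \<le> C * (norm (a - b) + norm (p - q))"
      if R: "norm p \<le> R" "norm q \<le> R" for p q
    proof -
      have "norm (christoffel G a p p - christoffel G b p p)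
          \<le> (\<Sum>c\<in>B. \<Sum>d\<in>B. norm (christoffel G a c d - christoffel G b c d)) * norm p * norm p"
        by (rule bilinear_bound) (intro bilinear_diff bil)
      also have "\<dots> \<le> (\<Sum>c\<in>B. \<Sum>d\<in>B. L * norm (a - b)) * R * R"
        using elim i R \<open>0 \<le> L\<close> \<open>0 \<le> R\<close>
        by (intro mult_mono sum_mono sum_nonneg mult_nonneg_nonneg) auto
      finally have 1: "norm (christoffel G a p p - christoffel G b p p) \<le> n * n * L * R * R * norm (a - b)"
        by (simp add: n_def mult_ac)
      have N_bound: "norm (christoffel G b u v) \<le> (N x + 1) * norm u * norm v" for u v
        using bilinear_bound[OF bil(2), of u v] elim i unfolding N_def[symmetric]
        by (auto elim!: order_trans intro!: mult_right_mono)
      have "norm (christoffel G b (p - q) p) \<le> (N x + 1) * norm (p - q) * norm p"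
        by (rule N_bound)
      also have "\<dots> \<le> (N x + 1) * norm (p - q) * R"
        using R \<open>0 \<le> N x\<close> by (intro mult_left_mono) auto
      finally have 2: "norm (christoffel G b (p - q) p) \<le> (N x + 1) * R * norm (p - q)"
        by (simp add: mult_ac)
      have "norm (christoffel G b q (p - q)) \<le> (N x + 1) * norm q * norm (p - q)"
        by (rule N_bound)
      also have "\<dots> \<le> (N x + 1) * R * norm (p - q)"
        using R \<open>0 \<le> N x\<close> by (intro mult_right_mono mult_left_mono) auto
      finally have 3: "norm (christoffel G b q (p - q)) \<le> (N x + 1) * R * norm (p - q)" .
      \<comment> \<open>One argument is changed at a time: first the base point, then each of the
        two velocity slots.\<close>
      let ?X = "christoffel G a p p - christoffel G b p p"
        and ?Y = "christoffel G b (p - q) p" and ?Z = "christoffel G b q (p - q)"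
      have eq: "christoffel G a p p - christoffel G b q q = ?X + ?Y + ?Z"
        by (simp add: bilinear_lsub[OF bil(2)] bilinear_rsub[OF bil(2)])
      have "norm (christoffel G a p p - christoffel G b q q) \<le> norm ?X + norm ?Y + norm ?Z"
        unfolding eq using norm_triangle_ineq[of "?X + ?Y" ?Z] norm_triangle_ineq[of ?X ?Y] by linarith
      also have "\<dots> \<le> n * n * L * R * R * norm (a - b) + 2 * ((N x + 1) * R) * norm (p - q)"
        using 1 2 3 by simp
      also have "\<dots> \<le> C * norm (a - b) + C * norm (p - q)"
        using \<open>0 \<le> L\<close> \<open>0 \<le> N x\<close> \<open>0 \<le> R\<close>
        by (intro add_mono mult_right_mono) (auto simp: C_def n_def)
      finally show ?thesis by (simp add: distrib_left)
    qed
    then show ?case using i by simp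
  qed
  then show ?thesis using that \<open>0 \<le> C\<close> by blast
qed

section \<open>Local uniqueness for the geodesic equation\<close>

lemma geodesic_equation_local_unique:
  assumes sol: "\<forall>\<^sub>F t in nhds t0. (y has_vector_derivative p t) (at t) \<and>
        (p has_vector_derivative - christoffel G (y t) (p t) (p t)) (at t)"
    and sol': "\<forall>\<^sub>F t in nhds t0. (y' has_vector_derivative p' t) (at t) \<and>
        (p' has_vector_derivative - christoffel G (y' t) (p' t) (p' t)) (at t)"
    and init: "y t0 \<in> S" "y t0 = y' t0" "p t0 = p' t0"
  shows "\<forall>\<^sub>F t in nhds t0. y t = y' t"
proof -
  \<comment> \<open>Both velocities equal \<open>p t0\<close> at \<open>t0\<close>, so by continuity
    they stay below \<open>R\<close> nearby.\<close>
  define R where "R = norm (p t0) + 1"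
  obtain C where "0 \<le> C" and C: "\<forall>\<^sub>F (a, b) in nhds (y t0, y t0). \<forall>p q. norm p \<le> R \<longrightarrow> norm q \<le> R \<longrightarrow>
    norm (christoffel G a p p - christoffel G b q q) \<le> C * (norm (a - b) + norm (p - q))"
    using christoffel_quadratic_lip[OF init(1), of R] unfolding R_def by auto
  have cont: "(y \<longlongrightarrow> y t0) (nhds t0)" "(p \<longlongrightarrow> p t0) (nhds t0)"
      "(y' \<longlongrightarrow> y t0) (nhds t0)" "(p' \<longlongrightarrow> p t0) (nhds t0)"
    using eventually_nhds_x_imp_x[OF sol] eventually_nhds_x_imp_x[OF sol'] init(2,3)
      isCont_tendsto_nhds[of t0 y] isCont_tendsto_nhds[of t0 p]
      isCont_tendsto_nhds[of t0 y'] isCont_tendsto_nhds[of t0 p']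
    by (auto dest!: has_vector_derivative_continuous)
  \<comment> \<open>Squared distance of the two solutions in position and velocity together. The
    square is differentiable where the distance itself may fail to be.\<close>
  define \<delta> where "\<delta> t = (y t - y' t) \<bullet> (y t - y' t) + (p t - p' t) \<bullet> (p t - p' t)" for t
  define \<delta>' where "\<delta>' t = 2 * ((y t - y' t) \<bullet> (p t - p' t))
      - 2 * ((p t - p' t) \<bullet> (christoffel G (y t) (p t) (p t) - christoffel G (y' t) (p' t) (p' t)))" for t
  have "((\<lambda>t. (y t, y' t)) \<longlongrightarrow> (y t0, y t0)) (nhds t0)"
    by (intro tendsto_Pair cont)
  from filterlim_iff[THEN iffD1, OF this, rule_format, OF C]
  have C': "\<forall>\<^sub>F t in nhds t0. \<forall>p q. norm p \<le> R \<longrightarrow> norm q \<le> R \<longrightarrow>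
    norm (christoffel G (y t) p p - christoffel G (y' t) q q) \<le> C * (norm (y t - y' t) + norm (p - q))"
    by simp
  have R: "\<forall>\<^sub>F t in nhds t0. norm (p t) < R" "\<forall>\<^sub>F t in nhds t0. norm (p' t) < R"
    using order_tendstoD(2)[OF tendsto_norm[OF cont(2)], of R]
      order_tendstoD(2)[OF tendsto_norm[OF cont(4)], of R] by (auto simp: R_def)
  have "\<forall>\<^sub>F t in nhds t0. \<delta> t = 0"
  proof (rule gronwall_zero)
    show "0 \<le> \<delta> t" for t by (simp add: \<delta>_def)
    show "\<delta> t0 = 0" by (simp add: \<delta>_def init)
    \<comment> \<open>The constant comes from 2ab \<le> a^2 + b^2, applied to each of the two inner
      products in \<open>\<delta>'\<close> and once more to the square of the Lipschitz
      bound.\<close>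
    show "\<forall>\<^sub>F t in nhds t0. (\<delta> has_real_derivative \<delta>' t) (at t) \<and> \<bar>\<delta>' t\<bar> \<le> (2 + 2 * C\<^sup>2) * \<delta> t"
      using sol sol' C' R
    proof eventually_elim
      case (elim t)
      let ?y = "y t - y' t" and ?p = "p t - p' t"
        and ?c = "christoffel G (y t) (p t) (p t) - christoffel G (y' t) (p' t) (p' t)"
      have dy: "((\<lambda>t. y t - y' t) has_vector_derivative ?p) (at t)"
        using elim by (intro has_vector_derivative_diff) auto
      have dp: "((\<lambda>t. p t - p' t) has_vector_derivative - ?c) (at t)"
        using has_vector_derivative_diff[of p _ "at t" p'] elim by force
      have "(\<delta> has_vector_derivative ((?y \<bullet> ?p + ?p \<bullet> ?y) + (?p \<bullet> (- ?c) + (- ?c) \<bullet> ?p))) (at t)"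
        unfolding \<delta>_def
        by (intro has_vector_derivative_add
            bounded_bilinear.has_vector_derivative[OF bounded_bilinear_inner] dy dp)
      then have d: "(\<delta> has_real_derivative \<delta>' t) (at t)"
        unfolding has_real_derivative_iff_has_vector_derivative \<delta>'_def
        by (simp add: inner_commute algebra_simps)
      have c: "norm ?c \<le> C * (norm ?y + norm ?p)" using elim by auto
      have "2 * \<bar>?y \<bullet> ?p\<bar> \<le> 2 * norm ?y * norm ?p"
        using Cauchy_Schwarz_ineq2[of ?y ?p] by simp
      also have "\<dots> \<le> (norm ?y)\<^sup>2 + (norm ?p)\<^sup>2"
        by (rule sum_squares_bound)
      finally have 1: "2 * \<bar>?y \<bullet> ?p\<bar> \<le> (norm ?y)\<^sup>2 + (norm ?p)\<^sup>2" .
      have "2 * \<bar>?p \<bullet> ?c\<bar> \<le> 2 * norm ?p * norm ?c"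
        using Cauchy_Schwarz_ineq2[of ?p ?c] by simp
      also have "\<dots> \<le> (norm ?p)\<^sup>2 + (norm ?c)\<^sup>2"
        by (rule sum_squares_bound)
      also have "(norm ?c)\<^sup>2 \<le> (C * (norm ?y + norm ?p))\<^sup>2"
        using c by (intro power_mono) auto
      also have "\<dots> = C\<^sup>2 * (norm ?y + norm ?p)\<^sup>2" by (simp add: power_mult_distrib)
      also have "\<dots> \<le> C\<^sup>2 * (2 * ((norm ?y)\<^sup>2 + (norm ?p)\<^sup>2))"
        using sum_squares_bound[of "norm ?y" "norm ?p"]
        by (intro mult_left_mono) (auto simp: power2_sum)
      finally have 2: "2 * \<bar>?p \<bullet> ?c\<bar> \<le> (norm ?p)\<^sup>2 + C\<^sup>2 * (2 * ((norm ?y)\<^sup>2 + (norm ?p)\<^sup>2))"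
        by simp
      have \<delta>: "\<delta> t = (norm ?y)\<^sup>2 + (norm ?p)\<^sup>2"
        by (simp add: \<delta>_def power2_norm_eq_inner)
      have "\<bar>\<delta>' t\<bar> \<le> 2 * \<bar>?y \<bullet> ?p\<bar> + 2 * \<bar>?p \<bullet> ?c\<bar>" unfolding \<delta>'_def by linarith
      also have "\<dots> \<le> (norm ?y)\<^sup>2 + (norm ?p)\<^sup>2 + ((norm ?p)\<^sup>2 + C\<^sup>2 * (2 * ((norm ?y)\<^sup>2 + (norm ?p)\<^sup>2)))"
        using 1 2 by (rule add_mono)
      also have "\<dots> \<le> (2 + 2 * C\<^sup>2) * \<delta> t"
        unfolding \<delta> by (simp add: algebra_simps)
      finally show ?case using d by blast
    qed
  qed
  then show ?thesis
    by (rule eventually_mono) (auto simp: \<delta>_def add_nonneg_eq_0_iff)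
qed

end

section \<open>Uniqueness of geodesics and the exponential map\<close>

lemma smooth_manifold_chartD:
  assumes "smooth_manifold A" and "c \<in> A"
  shows "open (chart_dom c)" and "open (chart_image c)"
    and "homeomorphism (chart_dom c) (chart_image c) (chart_map c) (chart_inv c)"
  using assms unfolding smooth_manifold_def is_chart_def by auto

lemma chart_at_mem:
  assumes "smooth_manifold A"
  shows "chart_at A x \<in> A" and "x \<in> chart_dom (chart_at A x)"
proof -
  have "\<exists>c. c \<in> A \<and> x \<in> chart_dom c"
    using assms unfolding smooth_manifold_def by blast
  from someI_ex[OF this] show "chart_at A x \<in> A" "x \<in> chart_dom (chart_at A x)"
    unfolding chart_at_def by auto
qed

lemma transition_has_derivative:
  fixes A :: "('m::{t2_space, second_countable_topology}, 'e::real_inner) chart set"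
  assumes A: "smooth_manifold A" and cd: "c \<in> A" "d \<in> A" and x: "x \<in> chart_dom c" "x \<in> chart_dom d"
  shows "(transition c d has_derivative tangent_coord_change c d x) (at (chart_map c x))"
proof -
  have "smooth_on (chart_map c ` (chart_dom c \<inter> chart_dom d)) (transition c d)"
    using A cd unfolding smooth_manifold_def by blast
  then have "Ck_on (Suc 0) (chart_map c ` (chart_dom c \<inter> chart_dom d)) (transition c d)"
    unfolding smooth_on_def by blast
  then have "transition c d differentiable (at (chart_map c x))"
    using x by auto
  then show ?thesis
    unfolding tangent_coord_change_def[abs_def] by (simp add: frechet_derivative_works)
qed

text \<open>Chain rule for \<open>transition d c \<circ> transition c d\<close>, which is the
  identity on the open set of \<open>c\<close>-coordinates of the overlap.\<close>

lemma tangent_coord_change_inverse: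
  fixes A :: "('m::{t2_space, second_countable_topology}, 'e::real_inner) chart set"
  assumes A: "smooth_manifold A" and cd: "c \<in> A" "d \<in> A" and x: "x \<in> chart_dom c" "x \<in> chart_dom d"
  shows "tangent_coord_change d c x (tangent_coord_change c d x v) = v"
proof -
  define U where "U = chart_map c ` (chart_dom c \<inter> chart_dom d)"
  note hom = smooth_manifold_chartD(3)[OF A cd(1)]
  have inv: "chart_inv c (chart_map c z) = z" if "z \<in> chart_dom c" for z
    using hom that by (rule homeomorphism_apply1)
  have inv': "chart_inv d (chart_map d z) = z" if "z \<in> chart_dom d" for z
    using smooth_manifold_chartD(3)[OF A cd(2)] that by (rule homeomorphism_apply1)
  have "openin (top_of_set (chart_image c)) U"
    unfolding U_def using smooth_manifold_chartD(1)[OF A] cd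
    by (intro homeomorphism_imp_open_map[OF hom] openin_open_Int) auto
  then have "open U"
    using smooth_manifold_chartD(2)[OF A cd(1)] by (simp add: openin_open_eq)
  have "(transition d c has_derivative tangent_coord_change d c x) (at (transition c d (chart_map c x)))"
    using transition_has_derivative[OF A cd(2,1) x(2,1)] x by (simp add: transition_def inv)
  from diff_chain_at[OF transition_has_derivative[OF A cd x] this]
  have "(transition d c \<circ> transition c d has_derivative tangent_coord_change d c x \<circ> tangent_coord_change c d x)
      (at (chart_map c x))" .
  then have "((\<lambda>y. y) has_derivative tangent_coord_change d c x \<circ> tangent_coord_change c d x)
      (at (chart_map c x))"
  proof (rule has_derivative_transform_within_open[OF _ \<open>open U\<close>])
    show "chart_map c x \<in> U" using x by (auto simp: U_def)
    show "(transition d c \<circ> transition c d) y = y" if "y \<in> U" for y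
      using that by (auto simp: U_def transition_def inv inv')
  qed
  then have "tangent_coord_change d c x \<circ> tangent_coord_change c d x = (\<lambda>y. y)"
    using has_derivative_unique has_derivative_ident by blast
  then show ?thesis by (metis comp_apply)
qed

text \<open>In the chart the metric is the pullback of \<open>g x\<close> by the linear coordinate
  change \<open>\<tau>\<close>. It stays definite because \<open>\<tau>\<close> has a linear left
  inverse.\<close>

lemma metric_field_local_metric:
  fixes A :: "('m::{t2_space, second_countable_topology}, 'e::real_inner) chart set"
  assumes A: "smooth_manifold A" and g: "riemannian_metric A g" and c: "c \<in> A"
    and B: "finite_orthonormal_basis B"
  shows "metric_field B (chart_image c) (local_metric A g c)"
proof -
  interpret finite_orthonormal_basis B by fact
  have form: "bilinear (g x)" "v \<noteq> 0 \<Longrightarrow> 0 < g x v v" for x v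
    using g unfolding riemannian_metric_def by auto
  show ?thesis
  proof unfold_locales
    show "open (chart_image c)" using smooth_manifold_chartD(2)[OF A c] .
    show "smooth_on (chart_image c) (\<lambda>y. local_metric A g c y u v)" for u v
      using g c unfolding riemannian_metric_def by blast
    fix y assume y: "y \<in> chart_image c"
    define x where "x = chart_inv c y"
    define \<tau> where "\<tau> = tangent_coord_change c (chart_at A x) x"
    have x: "x \<in> chart_dom c"
      using y smooth_manifold_chartD(3)[OF A c] unfolding x_def homeomorphism_def by blast
    note at = chart_at_mem[OF A, of x]
    have "linear \<tau>"
      unfolding \<tau>_def using has_derivative_linear[OF transition_has_derivative[OF A c at(1) x at(2)]] .
    have G: "local_metric A g c y u v = g x (\<tau> u) (\<tau> v)" for u v
      unfolding local_metric_def x_def \<tau>_def Let_def ..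
    show "bilinear (local_metric A g c y)"
      unfolding bilinear_def G
      by (auto intro!: linearI simp: linear_add[OF \<open>linear \<tau>\<close>] linear_cmul[OF \<open>linear \<tau>\<close>]
          bilinear_ladd[OF form(1)] bilinear_radd[OF form(1)] bilinear_lmul[OF form(1)] bilinear_rmul[OF form(1)])
    show "0 < local_metric A g c y u u" if "u \<noteq> 0" for u
    proof -
      have "\<tau> u \<noteq> 0"
      proof
        assume "\<tau> u = 0"
        then have "u = tangent_coord_change (chart_at A x) c x 0"
          using tangent_coord_change_inverse[OF A c at(1) x at(2), of u] unfolding \<tau>_def by simp
        also have "\<dots> = 0"
          using has_derivative_linear[OF transition_has_derivative[OF A at(1) c at(2) x]] by (rule linear_0)
        finally show False using that by simp
      qed
      then show ?thesis unfolding G by (rule form(2))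
    qed
  qed
qed

section \<open>Geodesics in charts and their uniqueness\<close>

context
  fixes A :: "('m::{t2_space, second_countable_topology}, 'e::real_inner) chart set"
    and g :: "'m \<Rightarrow> 'e \<Rightarrow> 'e \<Rightarrow> real"
  assumes A: "smooth_manifold A" and g: "riemannian_metric A g"
begin

lemma metric_field_chart:
  assumes "c \<in> A"
  obtains B where "metric_field B (chart_image c) (local_metric A g c)"
proof -
  obtain C :: "'e set" where "finite C" "span C = UNIV"
    using A unfolding smooth_manifold_def by blast
  then obtain B :: "'e set" where "finite_orthonormal_basis B"
    by (rule finite_orthonormal_basis_exists)
  then show ?thesis
    using metric_field_local_metric[OF A g assms] that by blast
qed

text \<open>Continuity keeps the geodesic in the open chart domain for nearby times, so the equation
  holds on a whole neighbourhood of \<open>t0\<close>, as the local uniqueness argument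
  requires.\<close>

lemma is_geodesic_chart_equation:
  assumes \<gamma>: "is_geodesic A g \<gamma>" and c: "c \<in> A" and t0: "\<gamma> t0 \<in> chart_dom c"
  defines "y \<equiv> chart_map c \<circ> \<gamma>"
  defines "p \<equiv> \<lambda>s. vector_derivative y (at s)"
  shows "\<forall>\<^sub>F t in nhds t0. \<gamma> t \<in> chart_dom c \<and> (y has_vector_derivative p t) (at t) \<and>
    (p has_vector_derivative - christoffel (local_metric A g c) (y t) (p t) (p t)) (at t)"
proof -
  have "isCont \<gamma> t0"
    using \<gamma> unfolding is_geodesic_def by (simp add: continuous_on_eq_continuous_at)
  then have "\<forall>\<^sub>F t in nhds t0. \<gamma> t \<in> chart_dom c"
    using topological_tendstoD[OF _ smooth_manifold_chartD(1)[OF A c] t0] isCont_tendsto_nhds by blast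
  then show ?thesis
  proof eventually_elim
    case (elim t)
    then have "y differentiable (at t)"
      "(p has_vector_derivative - christoffel (local_metric A g c) (y t) (p t) (p t)) (at t)"
      using \<gamma> c unfolding is_geodesic_def Let_def p_def y_def by blast+
    then show ?case
      using elim unfolding p_def by (simp add: vector_derivative_works)
  qed
qed

lemma is_geodesic_local_unique:
  assumes \<gamma>: "is_geodesic A g \<gamma>" "is_geodesic A g \<gamma>'" and c: "c \<in> A"
    and t0: "\<gamma> t0 \<in> chart_dom c" "\<gamma> t0 = \<gamma>' t0"
    and vel: "vector_derivative (chart_map c \<circ> \<gamma>) (at t0) = vector_derivative (chart_map c \<circ> \<gamma>') (at t0)"
  shows "\<forall>\<^sub>F t in nhds t0. \<gamma> t = \<gamma>' t"
proof -
  obtain B where "metric_field B (chart_image c) (local_metric A g c)"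
    using metric_field_chart[OF c] .
  then interpret metric_field B "chart_image c" "local_metric A g c" .
  have t0': "\<gamma>' t0 \<in> chart_dom c" using t0 by simp
  note eq = is_geodesic_chart_equation[OF \<gamma>(1) c t0(1)]
  note eq' = is_geodesic_chart_equation[OF \<gamma>(2) c t0']
  have "\<forall>\<^sub>F t in nhds t0. (chart_map c \<circ> \<gamma>) t = (chart_map c \<circ> \<gamma>') t"
  proof (rule geodesic_equation_local_unique)
    show "(chart_map c \<circ> \<gamma>) t0 \<in> chart_image c" using t0 by (simp add: chart_image_def)
    show "(chart_map c \<circ> \<gamma>) t0 = (chart_map c \<circ> \<gamma>') t0" using t0 by simp
    show "vector_derivative (chart_map c \<circ> \<gamma>) (at t0) = vector_derivative (chart_map c \<circ> \<gamma>') (at t0)"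
      by (rule vel)
  qed (rule eventually_mono[OF eq] eventually_mono[OF eq'], blast)+
  with eq eq' show ?thesis
  proof eventually_elim
    case (elim t)
    then show ?case
      using homeomorphism_apply1[OF smooth_manifold_chartD(3)[OF A c]] by (metis comp_apply)
  qed
qed

lemma geodesic_from_unique:
  assumes "geodesic_from A g x v \<gamma>" and "geodesic_from A g x v \<gamma>'"
  shows "\<gamma> = \<gamma>'"
proof -
  have geo: "is_geodesic A g \<gamma>" "is_geodesic A g \<gamma>'"
    using assms unfolding geodesic_from_def by auto
  have cont: "continuous_on UNIV \<gamma>" "continuous_on UNIV \<gamma>'"
    using geo unfolding is_geodesic_def by auto
  \<comment> \<open>Agreement near a time, not just at it, forces equal velocities in every chart at once.\<close>
  define E where "E = {t. \<forall>\<^sub>F s in nhds t. \<gamma> s = \<gamma>' s}"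
  have "open E"
  proof (subst open_subopen, intro ballI)
    fix t assume "t \<in> E"
    then obtain T where T: "open T" "t \<in> T" "\<forall>s\<in>T. \<gamma> s = \<gamma>' s"
      unfolding E_def eventually_nhds by auto
    then have "T \<subseteq> E" unfolding E_def eventually_nhds by blast
    then show "\<exists>T. open T \<and> t \<in> T \<and> T \<subseteq> E" using T by blast
  qed
  moreover have "closed E"
    unfolding closed_sequential_limits
  proof (intro allI impI, elim conjE)
    fix s t assume s: "\<forall>n. s n \<in> E" and lim: "s \<longlonglongrightarrow> t"
    have agree: "\<gamma> (s n) = \<gamma>' (s n)" for n
      using s eventually_nhds_x_imp_x unfolding E_def by blast
    have closed_agree: "closed {s. \<gamma> s = \<gamma>' s}"
      using cont by (rule closed_Collect_eq)
    have t: "\<gamma> t = \<gamma>' t"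
      using closed_sequentially[OF closed_agree _ lim] agree by simp
    define c where "c = chart_at A (\<gamma> t)"
    have c: "c \<in> A" "\<gamma> t \<in> chart_dom c" "\<gamma>' t \<in> chart_dom c"
      using chart_at_mem[OF A, of "\<gamma> t"] t by (auto simp: c_def)
    define p where "p = (\<lambda>r. vector_derivative (chart_map c \<circ> \<gamma>) (at r))"
    define p' where "p' = (\<lambda>r. vector_derivative (chart_map c \<circ> \<gamma>') (at r))"
    \<comment> \<open>Functions that agree near \<open>s n\<close> have the same
      \<open>vector_derivative\<close> there, even if the curves are outside the domain of
      \<open>c\<close> at that time.\<close>
    have "p (s n) = p' (s n)" for n
      unfolding p_def p'_def
    proof (rule vector_derivative_cong_eq)
      have "\<forall>\<^sub>F r in nhds (s n). \<gamma> r = \<gamma>' r" using s by (simp add: E_def)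
      then show "\<forall>\<^sub>F r in nhds (s n). r \<in> UNIV \<longrightarrow> (chart_map c \<circ> \<gamma>) r = (chart_map c \<circ> \<gamma>') r"
        by (rule eventually_mono) simp
    qed auto
    \<comment> \<open>At \<open>t\<close> the curves are inside the chart. By the geodesic equation
      the velocities are differentiable there, hence continuous, and their equality passes to the
      limit.\<close>
    moreover have "isCont p t" "isCont p' t"
      using eventually_nhds_x_imp_x[OF is_geodesic_chart_equation[OF geo(1) c(1,2)]]
        eventually_nhds_x_imp_x[OF is_geodesic_chart_equation[OF geo(2) c(1,3)]]
      unfolding p_def p'_def by (blast intro: has_vector_derivative_continuous)+
    then have "(\<lambda>n. p (s n)) \<longlonglongrightarrow> p t" "(\<lambda>n. p' (s n)) \<longlonglongrightarrow> p' t"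
      using lim isCont_tendsto_compose by blast+
    ultimately have "p t = p' t"
      by (simp add: LIMSEQ_unique)
    then show "t \<in> E"
      using is_geodesic_local_unique[OF geo c(1,2) t] unfolding E_def p_def p'_def by simp
  qed
  moreover have "0 \<in> E"
    using is_geodesic_local_unique[OF geo chart_at_mem(1)[OF A, of x], of 0] chart_at_mem(2)[OF A, of x] assms
    unfolding E_def geodesic_from_def by simp
  ultimately have "E = UNIV"
    using clopen[of E] by blast
  then show ?thesis
    using eventually_nhds_x_imp_x unfolding E_def by blast
qed

section \<open>Reparametrisation of geodesics and the exponential map\<close>

lemma geodesic_from_rescale:
  assumes "geodesic_from A g x v \<gamma>"
  shows "geodesic_from A g x (r *\<^sub>R v) (\<lambda>t. \<gamma> (r * t))"
proof -
  have geo: "is_geodesic A g \<gamma>" and x: "\<gamma> 0 = x"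
    and v: "vector_derivative (chart_map (chart_at A x) \<circ> \<gamma>) (at 0) = v"
    using assms unfolding geodesic_from_def by auto
  have scale: "((\<lambda>t. r * t) has_vector_derivative r) (at t)" for t
    unfolding has_real_derivative_iff_has_vector_derivative[symmetric]
    by (auto intro!: derivative_eq_intros)
  have chain: "((\<lambda>t. f (r * t)) has_vector_derivative r *\<^sub>R f') (at t)"
    if "(f has_vector_derivative f') (at (r * t))" for f :: "real \<Rightarrow> 'e" and f' t
    using vector_diff_chain_at[OF scale that] by (simp add: o_def)
  have local_eq: "(Y has_vector_derivative r *\<^sub>R p (r * t)) (at t) \<and>
      ((\<lambda>s. vector_derivative Y (at s)) has_vector_derivative
        - christoffel (local_metric A g c) (Y t) (r *\<^sub>R p (r * t)) (r *\<^sub>R p (r * t))) (at t)"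
    if c: "c \<in> A" and t: "\<gamma> (r * t) \<in> chart_dom c"
      and Y: "Y = chart_map c \<circ> (\<lambda>t. \<gamma> (r * t))"
      and p: "p = (\<lambda>s. vector_derivative (chart_map c \<circ> \<gamma>) (at s))" for c t Y p
  proof -
    obtain B where "metric_field B (chart_image c) (local_metric A g c)"
      using metric_field_chart[OF c] .
    then interpret metric_field B "chart_image c" "local_metric A g c" .
    let ?y = "chart_map c \<circ> \<gamma>"
    have Y': "Y = (\<lambda>t. ?y (r * t))" by (simp add: Y o_def)
    have eq: "\<forall>\<^sub>F s in nhds (r * t). \<gamma> s \<in> chart_dom c \<and> (?y has_vector_derivative p s) (at s) \<and>
        (p has_vector_derivative - christoffel (local_metric A g c) (?y s) (p s) (p s)) (at s)"
      unfolding p by (rule is_geodesic_chart_equation[OF geo c t])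
    have "((\<lambda>t. r * t) \<longlongrightarrow> r * t) (nhds t)"
      by (intro tendsto_mult tendsto_const filterlim_ident)
    from filterlim_iff[THEN iffD1, OF this, rule_format, OF eq]
    have "\<forall>\<^sub>F s in nhds t. (?y has_vector_derivative p (r * s)) (at (r * s))"
      by (rule eventually_mono) blast
    then have Yder: "\<forall>\<^sub>F s in nhds t. (Y has_vector_derivative r *\<^sub>R p (r * s)) (at s)"
      by (rule eventually_mono) (simp only: Y' chain)
    \<comment> \<open>The velocity of \<open>Y\<close> has to be known on a neighbourhood of
      \<open>t\<close>, since it is differentiated once more.\<close>
    then have vel: "\<forall>\<^sub>F s in nhds t. r *\<^sub>R p (r * s) = vector_derivative Y (at s)"
      by (rule eventually_mono) (rule vector_derivative_at[symmetric])
    have "(p has_vector_derivative - christoffel (local_metric A g c) (?y (r * t)) (p (r * t)) (p (r * t))) (at (r * t))"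
      using eventually_nhds_x_imp_x[OF eq] by blast
    from has_vector_derivative_scaleR[OF DERIV_const[of r] chain[OF this]]
    have "((\<lambda>s. r *\<^sub>R p (r * s)) has_vector_derivative
        r *\<^sub>R r *\<^sub>R - christoffel (local_metric A g c) (?y (r * t)) (p (r * t)) (p (r * t))) (at t)"
      by simp
    \<comment> \<open>The acceleration picks up the factor \<open>r\<close> twice; bilinearity moves
      one factor into each velocity slot.\<close>
    also have "r *\<^sub>R r *\<^sub>R - christoffel (local_metric A g c) (?y (r * t)) (p (r * t)) (p (r * t))
        = - christoffel (local_metric A g c) (Y t) (r *\<^sub>R p (r * t)) (r *\<^sub>R p (r * t))"
    proof -
      have "Y t \<in> chart_image c" using t by (simp add: Y chart_image_def)
      from bilinear_christoffel[OF this] show ?thesis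
        by (simp add: Y' bilinear_lmul bilinear_rmul)
    qed
    finally have "((\<lambda>s. vector_derivative Y (at s)) has_vector_derivative
        - christoffel (local_metric A g c) (Y t) (r *\<^sub>R p (r * t)) (r *\<^sub>R p (r * t))) (at t)"
      using has_vector_derivative_cong_ev[where S = UNIV and x = t and f = "\<lambda>s. r *\<^sub>R p (r * s)"
          and g = "\<lambda>s. vector_derivative Y (at s)"] vel eventually_nhds_x_imp_x[OF vel] by simp
    then show ?thesis using eventually_nhds_x_imp_x[OF Yder] by blast
  qed
  show ?thesis
    unfolding geodesic_from_def is_geodesic_def Let_def
  proof (intro conjI ballI allI impI)
    show "continuous_on UNIV (\<lambda>t. \<gamma> (r * t))"
      using geo unfolding is_geodesic_def
      by (auto intro!: continuous_on_compose2[of UNIV \<gamma>] continuous_intros)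
    show "\<gamma> (r * 0) = x" using x by simp
    have "\<gamma> (r * 0) \<in> chart_dom (chart_at A x)" using x chart_at_mem[OF A, of x] by simp
    from local_eq[OF chart_at_mem(1)[OF A] this refl refl]
    show "vector_derivative (chart_map (chart_at A x) \<circ> (\<lambda>t. \<gamma> (r * t))) (at 0) = r *\<^sub>R v"
      using v by (auto intro: vector_derivative_at)
    fix c t assume c: "c \<in> A" and t: "\<gamma> (r * t) \<in> chart_dom c"
    note eq = local_eq[OF c t refl refl]
    then show "chart_map c \<circ> (\<lambda>t. \<gamma> (r * t)) differentiable at t"
      by (blast intro: differentiableI_vector)
    show "((\<lambda>s. vector_derivative (chart_map c \<circ> (\<lambda>t. \<gamma> (r * t))) (at s)) has_vector_derivative
        - christoffel (local_metric A g c) ((chart_map c \<circ> (\<lambda>t. \<gamma> (r * t))) t)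
          (vector_derivative (chart_map c \<circ> (\<lambda>t. \<gamma> (r * t))) (at t))
          (vector_derivative (chart_map c \<circ> (\<lambda>t. \<gamma> (r * t))) (at t))) (at t)"
      using eq vector_derivative_at[OF conjunct1[OF eq]] by (simp only:)
  qed
qed

text \<open>The geodesic with initial velocity \<open>t *\<^sub>R v\<close> at time 1 is the one
  with velocity \<open>v\<close> at time \<open>t\<close>. Uniqueness makes the definite description
  in \<open>riem_exp\<close> pick exactly this rescaled curve.\<close>

lemma riem_exp_geodesic:
  assumes "geodesic_from A g x v \<gamma>"
  shows "riem_exp A g x (t *\<^sub>R v) = \<gamma> t"
proof -
  have "(THE \<gamma>. geodesic_from A g x (t *\<^sub>R v) \<gamma>) = (\<lambda>s. \<gamma> (t * s))"
    using geodesic_from_rescale[OF assms] geodesic_from_unique by blast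
  then show ?thesis by (simp add: riem_exp_def)
qed

text \<open>In a fixed direction the exponential map follows a single geodesic, so continuity of
  that curve at time 0 suffices.\<close>

lemma riem_exp_tendsto:
  assumes "complete_metric A g"
  shows "((\<lambda>t. riem_exp A g x (t *\<^sub>R v)) \<longlongrightarrow> x) (at_right 0)"
proof -
  obtain \<gamma> where \<gamma>: "geodesic_from A g x v \<gamma>"
    using assms unfolding complete_metric_def by blast
  then have "isCont \<gamma> 0" "\<gamma> 0 = x"
    unfolding geodesic_from_def is_geodesic_def by (simp_all add: continuous_on_eq_continuous_at)
  then have "(\<gamma> \<longlongrightarrow> x) (at_right 0)"
    by (metis continuous_at filterlim_at_split)
  then show ?thesis by (simp add: riem_exp_geodesic[OF \<gamma>])
qed

end

section \<open>Interval valued functions\<close>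

text \<open>In end point coordinates the Hausdorff distance is the maximum metric of the
  plane.\<close>

lemma ivl_tendsto_iff:
  "ivl_tendsto F L net \<longleftrightarrow>
     ((\<lambda>t. lower (F t)) \<longlongrightarrow> lower L) net \<and> ((\<lambda>t. upper (F t)) \<longlongrightarrow> upper L) net"
proof
  assume "ivl_tendsto F L net"
  then have lim: "((\<lambda>t. max \<bar>lower (F t) - lower L\<bar> \<bar>upper (F t) - upper L\<bar>) \<longlongrightarrow> 0) net"
    by (simp add: ivl_tendsto_def ivl_dist_def)
  have "((\<lambda>t. lower (F t) - lower L) \<longlongrightarrow> 0) net" "((\<lambda>t. upper (F t) - upper L) \<longlongrightarrow> 0) net"
    by (rule Lim_null_comparison[OF always_eventually lim], simp)+
  then show "((\<lambda>t. lower (F t)) \<longlongrightarrow> lower L) net \<and> ((\<lambda>t. upper (F t)) \<longlongrightarrow> upper L) net"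
    by (simp add: LIM_zero_iff)
next
  assume lim: "((\<lambda>t. lower (F t)) \<longlongrightarrow> lower L) net \<and> ((\<lambda>t. upper (F t)) \<longlongrightarrow> upper L) net"
  then have "((\<lambda>t. max \<bar>lower (F t) - lower L\<bar> \<bar>upper (F t) - upper L\<bar>) \<longlongrightarrow>
      max \<bar>lower L - lower L\<bar> \<bar>upper L - upper L\<bar>) net"
    by (intro tendsto_max tendsto_rabs tendsto_diff tendsto_const) auto
  then show "ivl_tendsto F L net"
    by (simp add: ivl_tendsto_def ivl_dist_def)
qed

text \<open>Uniqueness of one-sided limits at both end points justifies the \<open>THE\<close> in
  \<open>gH_deriv\<close>.\<close>

lemma has_gH_dir_deriv_gH_deriv:
  assumes "gH_dir_differentiable A g f x"
  shows "has_gH_dir_deriv A g f x v (gH_deriv A g f x v)"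
proof -
  obtain L where L: "has_gH_dir_deriv A g f x v L"
    using assms unfolding gH_dir_differentiable_def by blast
  show ?thesis
    unfolding gH_deriv_def
  proof (rule theI[where P = "has_gH_dir_deriv A g f x v", OF L])
    fix L' assume "has_gH_dir_deriv A g f x v L'"
    then show "L' = L"
      using L tendsto_unique[OF trivial_limit_at_right_real] unfolding has_gH_dir_deriv_def ivl_tendsto_iff
      by (blast intro: interval_eqI)
  qed
qed

text \<open>Scaling by the positive number \<open>1 / t\<close> does not swap end points. Both
  halves of the theorem compare the sign of this upper end point.\<close>

lemma upper_gH_deriv_tendsto:
  assumes "gH_dir_differentiable A g f x"
  shows "((\<lambda>t. upper (gH_diff (f (riem_exp A g x (t *\<^sub>R v))) (f x)) / t) \<longlongrightarrow>
    upper (gH_deriv A g f x v)) (at_right 0)"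
proof -
  have "((\<lambda>t. upper (ivl_scale (1 / t) (gH_diff (f (riem_exp A g x (t *\<^sub>R v))) (f x)))) \<longlongrightarrow>
      upper (gH_deriv A g f x v)) (at_right 0)"
    using has_gH_dir_deriv_gH_deriv[OF assms] unfolding has_gH_dir_deriv_def ivl_tendsto_iff by blast
  moreover have "\<forall>\<^sub>F t in at_right (0::real). 0 < t"
    by (rule eventually_at_right_less)
  then have "\<forall>\<^sub>F t in at_right 0. upper (ivl_scale (1 / t) (gH_diff (f (riem_exp A g x (t *\<^sub>R v))) (f x)))
      = upper (gH_diff (f (riem_exp A g x (t *\<^sub>R v))) (f x)) / t"
    by (rule eventually_mono) (simp add: upper_ivl_scale)
  ultimately show ?thesis by (rule Lim_transform_eventually)
qed

text \<open>The upper end point of the gH-difference is the larger of the two end point differences.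
  If it were negative, both end points would drop strictly.\<close>

lemma not_ivl_less_imp_upper_gH_diff_nonneg:
  assumes "\<not> ivl_less A B"
  shows "0 \<le> upper (gH_diff A B)"
proof (rule ccontr)
  assume "\<not> ?thesis"
  then have "lower A < lower B" "upper A < upper B" by (auto simp: upper_gH_diff)
  then show False using assms unfolding ivl_less_def ivl_le_def by auto
qed

section \<open>Sign of the derivative at efficient and at dominated points\<close>

lemma efficient_point_imp_upper_gH_deriv_nonneg:
  fixes A :: "('m::{t2_space, second_countable_topology}, 'e::real_inner) chart set"
  assumes "hadamard_manifold A g" and "open D" and "efficient_point f D x"
    and "gH_dir_differentiable A g f x"
  shows "0 \<le> upper (gH_deriv A g f x v)"
proof (rule tendsto_lowerbound[OF upper_gH_deriv_tendsto[OF assms(4)]])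
  have "((\<lambda>t. riem_exp A g x (t *\<^sub>R v)) \<longlongrightarrow> x) (at_right 0)"
    using assms(1) unfolding hadamard_manifold_def by (intro riem_exp_tendsto) auto
  moreover have "x \<in> D" using assms(3) by (simp add: efficient_point_def)
  ultimately have "\<forall>\<^sub>F t in at_right 0. riem_exp A g x (t *\<^sub>R v) \<in> D"
    using assms(2) by (auto dest: topological_tendstoD)
  then show "\<forall>\<^sub>F t in at_right 0. 0 \<le> upper (gH_diff (f (riem_exp A g x (t *\<^sub>R v))) (f x)) / t"
    using eventually_at_right_less[of 0]
  proof eventually_elim
    case (elim t)
    then have "\<not> ivl_less (f (riem_exp A g x (t *\<^sub>R v))) (f x)"
      using assms(3) by (simp add: efficient_point_def)
    then show ?case
      using elim by (simp add: not_ivl_less_imp_upper_gH_diff_nonneg)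
  qed
qed (rule trivial_limit_at_right_real)

lemma dominating_point_imp_upper_gH_deriv_nonpos:
  assumes convex: "geodesically_convex_on A g D f" and D: "x \<in> D" "y \<in> D"
    and less: "ivl_less (f y) (f x)" and diff: "gH_dir_differentiable A g f x"
  shows "upper (gH_deriv A g f x (riem_log A g x y)) \<le> 0"
proof (rule tendsto_upperbound[OF upper_gH_deriv_tendsto[OF diff]])
  have "\<forall>\<^sub>F t in at_right (0::real). t \<in> {0<..<1}"
    by (rule eventually_at_right_real) simp
  then show "\<forall>\<^sub>F t in at_right 0.
      upper (gH_diff (f (riem_exp A g x (t *\<^sub>R riem_log A g x y))) (f x)) / t \<le> 0"
  proof eventually_elim
    case (elim t)
    define F where "F = f (riem_exp A g x (t *\<^sub>R riem_log A g x y))"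
    have "ivl_le F (ivl_scale (1 - t) (f x) + ivl_scale t (f y))"
      using convex D elim unfolding geodesically_convex_on_def minimal_geodesic_def F_def by auto
    then have F: "lower F \<le> (1 - t) * lower (f x) + t * lower (f y)"
        "upper F \<le> (1 - t) * upper (f x) + t * upper (f y)"
      using elim by (auto simp: ivl_le_def lower_ivl_scale upper_ivl_scale)
    have "t * lower (f y) \<le> t * lower (f x)" "t * upper (f y) \<le> t * upper (f x)"
      using less elim unfolding ivl_less_def ivl_le_def by auto
    \<comment> \<open>Replacing \<open>f y\<close> by the larger \<open>f x\<close> in the convexity
      bound leaves \<open>f x\<close> itself, so neither end point of \<open>F\<close> exceeds that
      of \<open>f x\<close>.\<close>
    with F have "upper (gH_diff F (f x)) \<le> 0"
      by (simp add: upper_gH_diff algebra_simps)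
    then show ?case
      using elim unfolding F_def by (simp add: divide_nonpos_pos)
  qed
qed (rule trivial_limit_at_right_real)

theorem theorem4p2:
  fixes A :: "('m::{t2_space, second_countable_topology}, 'e::real_inner) chart set"
    and g :: "'m \<Rightarrow> 'e \<Rightarrow> 'e \<Rightarrow> real"
    and D :: "'m set"
    and f :: "'m \<Rightarrow> real interval"
    and x0 :: 'm
  assumes "hadamard_manifold A g"
    and "open D" and "D \<noteq> {}"
    and "x0 \<in> D"
    and "gH_gateaux_differentiable A g f x0"
  shows "(efficient_point f D x0 \<longrightarrow>
            (\<forall>x\<in>D. 0 \<in> set_of (gH_deriv A g f x0 (riem_log A g x0 x)))) \<and>
         (geodesically_convex_set A g D \<and> geodesically_convex_on A g D f \<and>
            (\<forall>x\<in>D - {x0}. 0 \<in> {lower (gH_deriv A g f x0 (riem_log A g x0 x)) ..<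
                                upper (gH_deriv A g f x0 (riem_log A g x0 x))}) \<longrightarrow>
            efficient_point f D x0)"
proof (intro conjI impI ballI)
  have diff: "gH_dir_differentiable A g f x0" and lin: "ivl_linear (gH_deriv A g f x0)"
    using assms(5) unfolding gH_gateaux_differentiable_def by auto
  {
    fix x assume eff: "efficient_point f D x0"
    let ?v = "riem_log A g x0 x"
    note nonneg = efficient_point_imp_upper_gH_deriv_nonneg[OF assms(1,2) eff diff]
    \<comment> \<open>Scaling by \<open>- 1\<close> swaps the end points: the upper one at
      \<open>- ?v\<close> is minus the lower one at \<open>?v\<close>.\<close>
    have "gH_deriv A g f x0 (- ?v) = ivl_scale (- 1) (gH_deriv A g f x0 ?v)"
      using lin unfolding ivl_linear_def by (metis scaleR_minus1_left)
    then have "lower (gH_deriv A g f x0 ?v) \<le> 0"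
      using nonneg[of "- ?v"] by (simp add: upper_ivl_scale)
    then show "0 \<in> set_of (gH_deriv A g f x0 ?v)"
      using nonneg[of ?v] by (simp add: set_of_eq)
  }
  assume *: "geodesically_convex_set A g D \<and> geodesically_convex_on A g D f \<and>
            (\<forall>x\<in>D - {x0}. 0 \<in> {lower (gH_deriv A g f x0 (riem_log A g x0 x)) ..<
                                upper (gH_deriv A g f x0 (riem_log A g x0 x))})"
  show "efficient_point f D x0"
    unfolding efficient_point_def
  proof (intro conjI ballI notI assms(4))
    fix x assume "x \<in> D" and less: "ivl_less (f x) (f x0)"
    then have "upper (gH_deriv A g f x0 (riem_log A g x0 x)) \<le> 0"
      using * assms(4) diff by (blast intro: dominating_point_imp_upper_gH_deriv_nonpos)
    \<comment> \<open>Strictness of the order excludes \<open>x0\<close>, so the condition on the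
      half-open interval applies to \<open>x\<close> and makes the upper end point positive.\<close>
    moreover have "x \<noteq> x0" using less unfolding ivl_less_def by auto
    ultimately show False using * \<open>x \<in> D\<close> by force
  qed
qed

end
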